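(* Let $f$ and $g$ be real analytic functions defined in a neighborhood of $0\in\mathbb{R}$, such that $g(0)=0$, $g'(0)=1$ and $x g(x)>0$ for $x\neq 0$. Then the planar system $$\dot x = y,\qquad \dot y = -g(x)-f(x)y^2$$ has an isochronous center at the origin $O=(0,0)$ if and only if there exists an odd analytic function $h$ such that for all $k\ge 0$, $$\widehat P_k(0)=\widehat Q_k(0),$$ with the recursive formulas $$\widehat P_0(\xi)=\xi,\qquad \widehat P_k(\xi)=\frac{d\widehat P_{k-1}(\xi)}{d\xi}\,(1+h(\xi))-(2k-1)\,\widehat P_{k-1}(\xi)\,\frac{dh(\xi)}{d\xi}\quad (k\ge 1),$$ $$\widehat Q_0(x)=g(x),\qquad \widehat Q_k(x)=\frac{d\widehat Q_{k-1}(x)}{dx}-(k-2)\,f(x)\,\widehat Q_{k-1}(x)\quad (k\ge 1).$$ Moreover, for all $M>0$, the $M$ first necessary conditions of isochronicity, $\widehat P_k(0)=\widehat Q_k(0)$ for $1\le k\le M$, can be obtained by computing the truncated power series expansions around $0$ of $\widehat P_k(\xi)$ and $\widehat Q_k(x)$ up to the order $M-k$.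
   Context: The system is the planar system associated with the Liénard type equation $\ddot x+f(x)\dot x^2+g(x)=0$. Under the hypotheses the origin is a center, i.e. it has a punctured neighborhood filled with nonconstant periodic orbits surrounding it; the center is isochronous if all periodic orbits in some neighborhood of the origin have the same period. Here $k$ and $M$ are integers, and $h$ is a function of one real variable defined in a neighborhood of $0$. *)

theory Defs
  imports "HOL-Analysis.Analysis"
begin

text \<open>
  The library predicate \<^const>\<open>analytic_on\<close> is complex differentiability, so real analyticity is
  defined through local convergence to a power series with real coefficients.
\<close>

definition real_analytic_on :: "(real \<Rightarrow> real) \<Rightarrow> real set \<Rightarrow> bool" where
  "real_analytic_on \<phi> S \<longleftrightarrow> (\<forall>a\<in>S. \<exists>F. (\<lambda>x. \<phi> (a + x)) has_fps_expansion F)"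

text \<open>A germ condition: \<open>h\<close> is only constrained on some interval around 0.\<close>

definition odd_analytic_near_0 :: "(real \<Rightarrow> real) \<Rightarrow> bool" where
  "odd_analytic_near_0 h \<longleftrightarrow>
     (\<exists>r>0. real_analytic_on h {-r<..<r} \<and> (\<forall>x\<in>{-r<..<r}. h (- x) = - h x))"


subsection \<open>Planar systems, centers, isochronicity\<close>

text \<open>Complete solutions of \<open>z' = X z\<close> for a vector field \<open>X\<close> on the domain \<open>D\<close>.\<close>

definition complete_solution ::
  "(real \<times> real \<Rightarrow> real \<times> real) \<Rightarrow> (real \<times> real) set \<Rightarrow> (real \<Rightarrow> real \<times> real) \<Rightarrow> bool" where
  "complete_solution X D z \<longleftrightarrow>
     (\<forall>t. z t \<in> D \<and> (z has_vector_derivative X (z t)) (at t))"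

text \<open>The least positive period. A constant curve has none, since each \<open>s > 0\<close> is a period of it.\<close>

definition least_period :: "(real \<Rightarrow> 'a) \<Rightarrow> real \<Rightarrow> bool" where
  "least_period z T \<longleftrightarrow>
     T > 0 \<and> (\<forall>t. z (t + T) = z t) \<and> (\<forall>s>0. (\<forall>t. z (t + s) = z t) \<longrightarrow> T \<le> s)"

text \<open>\<open>\<gamma>\<close> is a nonconstant periodic orbit of \<open>X\<close>, with period \<open>T\<close>.\<close>

definition periodic_orbit ::
  "(real \<times> real \<Rightarrow> real \<times> real) \<Rightarrow> (real \<times> real) set \<Rightarrow> real \<Rightarrow> (real \<times> real) set \<Rightarrow> bool" where
  "periodic_orbit X D T \<gamma> \<longleftrightarrow>
     (\<exists>z. complete_solution X D z \<and> least_period z T \<and> \<gamma> = range z)"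

text \<open>
  The punctured neighborhood \<open>U - {p}\<close> is the union of the periodic orbits that it contains and
  that surround \<open>p\<close>.
\<close>

definition is_center ::
  "(real \<times> real \<Rightarrow> real \<times> real) \<Rightarrow> (real \<times> real) set \<Rightarrow> real \<times> real \<Rightarrow> bool" where
  "is_center X D p \<longleftrightarrow>
     (\<exists>U. open U \<and> p \<in> U \<and> U \<subseteq> D \<and>
        (\<forall>q\<in>U - {p}. \<exists>T \<gamma>. periodic_orbit X D T \<gamma> \<and> q \<in> \<gamma> \<and> \<gamma> \<subseteq> U - {p} \<and> p \<in> inside \<gamma>))"

definition isochronous_center ::
  "(real \<times> real \<Rightarrow> real \<times> real) \<Rightarrow> (real \<times> real) set \<Rightarrow> real \<times> real \<Rightarrow> bool" where
  "isochronous_center X D p \<longleftrightarrow>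
     is_center X D p \<and>
     (\<exists>V T. open V \<and> p \<in> V \<and> (\<forall>\<gamma> S. periodic_orbit X D S \<gamma> \<and> \<gamma> \<subseteq> V \<longrightarrow> S = T))"

definition lienard_field :: "(real \<Rightarrow> real) \<Rightarrow> (real \<Rightarrow> real) \<Rightarrow> real \<times> real \<Rightarrow> real \<times> real" where
  "lienard_field f g = (\<lambda>(x, y). (y, - g x - f x * y\<^sup>2))"


subsection \<open>The recursive formulas\<close>

primrec P_hat :: "(real \<Rightarrow> real) \<Rightarrow> nat \<Rightarrow> real \<Rightarrow> real" where
  "P_hat h 0 = (\<lambda>\<xi>. \<xi>)"
| "P_hat h (Suc k) =
     (\<lambda>\<xi>. deriv (P_hat h k) \<xi> * (1 + h \<xi>) - (2 * real (Suc k) - 1) * P_hat h k \<xi> * deriv h \<xi>)"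

primrec Q_hat :: "(real \<Rightarrow> real) \<Rightarrow> (real \<Rightarrow> real) \<Rightarrow> nat \<Rightarrow> real \<Rightarrow> real" where
  "Q_hat f g 0 = g"
| "Q_hat f g (Suc k) =
     (\<lambda>x. deriv (Q_hat f g k) x - (real (Suc k) - 2) * f x * Q_hat f g k x)"


subsection \<open>The same recursion on truncated power series\<close>

text \<open>
  The real counterpart of the expansion operator that the library provides for complex functions
  only. It is meaningful when \<open>\<phi> has_fps_expansion taylor_fps \<phi>\<close>.
\<close>

definition taylor_fps :: "(real \<Rightarrow> real) \<Rightarrow> real fps" where
  "taylor_fps \<phi> = Abs_fps (\<lambda>n. (deriv ^^ n) \<phi> 0 / fact n)"

text \<open>
  Terms up to and including order \<open>n\<close>; both \<^const>\<open>truncate_fps\<close> and \<^const>\<open>poly_cutoff\<close>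
  keep only exponents strictly below their bound, hence the successors.
\<close>

definition truncated_expansion :: "nat \<Rightarrow> (real \<Rightarrow> real) \<Rightarrow> real poly" where
  "truncated_expansion n \<phi> = truncate_fps (Suc n) (taylor_fps \<phi>)"

text \<open>
  Purely polynomial recursions: only the expansions of the data \<open>h\<close>, \<open>f\<close>, \<open>g\<close> up to order \<open>M\<close> enter,
  and the \<open>k\<close>-th step keeps nothing beyond order \<open>M - k\<close>. The subtraction is truncated, so they are
  meaningful for \<open>k \<le> M\<close> only.
\<close>

primrec P_trunc :: "nat \<Rightarrow> (real \<Rightarrow> real) \<Rightarrow> nat \<Rightarrow> real poly" where
  "P_trunc M h 0 = poly_cutoff (Suc M) [:0, 1:]"
| "P_trunc M h (Suc k) =
     (let H = truncated_expansion M h; P = P_trunc M h k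
      in poly_cutoff (Suc (M - Suc k))
           (pderiv P * (1 + H) - smult (2 * real (Suc k) - 1) (P * pderiv H)))"

primrec Q_trunc :: "nat \<Rightarrow> (real \<Rightarrow> real) \<Rightarrow> (real \<Rightarrow> real) \<Rightarrow> nat \<Rightarrow> real poly" where
  "Q_trunc M f g 0 = truncated_expansion M g"
| "Q_trunc M f g (Suc k) =
     (let F = truncated_expansion M f; Q = Q_trunc M f g k
      in poly_cutoff (Suc (M - Suc k))
           (pderiv Q - smult (real (Suc k) - 2) (F * Q)))"

end

theory Submission
  imports Defs "HOL-Complex_Analysis.Complex_Analysis"
begin

text \<open>
  Let \<open>F' = f\<close> and \<open>F(0) = 0\<close>. The energy \<open>(y exp F)\<^sup>2 / 2 + \<integral> g exp (2 F)\<close> is a first integral of the system. Writing its two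
  summands as \<open>v\<^sup>2 / 2\<close> and \<open>\<xi>\<^sup>2 / 2\<close>, with \<open>\<xi>\<close> of the sign of \<open>x\<close>, gives coordinates near the
  origin; let \<open>X\<close> be the inverse of \<open>x \<mapsto> \<xi>\<close> and \<open>w(\<xi>) = exp (F (X \<xi>)) X'(\<xi>)\<close>, so that \<open>w(0) = 1\<close>.
  Then \<open>\<xi>' = v / w(\<xi>)\<close> and \<open>v' = -\<xi> / w(\<xi>)\<close>: orbits are circles run through with varying angular
  velocity, and the orbit of radius \<open>c\<close> has the period \<open>T(c) = \<integral> w(c sin s) ds\<close> over \<open>[0, 2 \<pi>]\<close>.
  Only the even part of \<open>w\<close> contributes, and \<open>T(c) \<longrightarrow> 2 \<pi>\<close> as \<open>c \<longrightarrow> 0\<close>.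
  If \<open>w\<close> has even part \<open>1\<close>, then \<open>T = 2 \<pi>\<close>. Otherwise, by analyticity, the even part of \<open>w\<close> minus \<open>1\<close>
  has a constant sign on some \<open>(0, \<delta>)\<close>, hence \<open>T(c) \<noteq> 2 \<pi>\<close> for small \<open>c\<close>. So the center is
  isochronous iff the germ \<open>w - 1\<close> is odd (lemmas
  \<open>isochronous_if_even_part_constant\<close> and \<open>even_part_constant_if_isochronous\<close>).

  It remains to recognise \<open>w - 1\<close> from the recursions. The restoring force
  \<open>g(x) exp (F x) = \<xi> / w(\<xi>)\<close> can be differentiated repeatedly by \<open>exp (-F) d/dx\<close>, which in the variable \<open>\<xi>\<close>
  is \<open>(1 / w) d/d\<xi>\<close>. The \<open>k\<close>-th derivative is \<open>Q\<^sub>k exp ((1 - k) F)\<close> in the first form and \<open>P\<^sub>k / w\<^bsup>2k+1\<^esup>\<close>, with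
  \<open>h = w - 1\<close>, in the second. At the origin this says \<open>P\<^sub>k(0) = Q\<^sub>k(0)\<close> for \<open>h = w - 1\<close>
  (lemma \<open>P_hat_eq_Q_hat_in_energy_coordinates\<close>). Conversely the numbers \<open>P\<^sub>k(0)\<close> determine the
  Taylor series of \<open>h\<close>, because the \<open>n\<close>-th coefficient of \<open>h\<close> enters \<open>P\<^bsub>n+1\<^esub>(0)\<close> linearly with a
  nonzero factor (lemma \<open>P_fps_at_0_determines_series\<close>); hence a solution \<open>h\<close> of the conditions
  coincides with \<open>w - 1\<close> near \<open>0\<close>.

  The statement on truncations holds because each step of either recursion loses exactly one order
  of accuracy, through the derivative.
\<close>

section \<open>Germs of real analytic functions\<close>

text \<open>
  Local at \<open>0\<close>: a germ in this sense is automatically analytic on a whole interval around \<open>0\<close>, as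
  \<open>analytic_germ_imp_real_analytic_on\<close> shows, so no other base point has to be considered.
\<close>

definition analytic_germ :: "(real \<Rightarrow> real) \<Rightarrow> bool" where
  "analytic_germ \<phi> \<longleftrightarrow> (\<exists>F. \<phi> has_fps_expansion F)"

lemma has_fps_expansion_at_0:
  assumes "\<phi> has_fps_expansion F"
  shows "\<phi> 0 = fps_nth F 0"
  using assms by (auto simp: has_fps_expansion_def eval_fps_at_0 dest: eventually_nhds_x_imp_x)

text \<open>
  The series, read with complex arguments, is the extension. It is set to \<open>0\<close> outside its disc of
  convergence, so that compatibility with conjugation, which comes from the coefficients being real,
  holds at every point.
\<close>

lemma fps_expansion_extends_holomorphically:
  assumes "\<phi> has_fps_expansion F"
  obtains G :: "complex \<Rightarrow> complex" where "G analytic_on {0}"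
    "\<forall>\<^sub>F x in nhds 0. G (of_real x) = of_real (\<phi> x)" "\<And>z. G (cnj z) = cnj (G z)"
proof -
  define C :: "complex fps" where "C = Abs_fps (\<lambda>n. of_real (fps_nth F n))"
  have rad: "fps_conv_radius C = fps_conv_radius F"
    by (simp add: C_def fps_conv_radius_def conv_radius_def)
  have pos: "fps_conv_radius F > 0"
    using assms by (simp add: has_fps_expansion_def)
  define G where "G z = (if ereal (norm z) < fps_conv_radius C then eval_fps C z else 0)" for z
  have "eval_fps C analytic_on {0}"
    by (rule analytic_on_eval_fps) (use pos rad in \<open>auto simp: zero_ereal_def\<close>)
  moreover have "\<forall>\<^sub>F z in nhds (0::complex). z \<in> eball 0 (fps_conv_radius C)"
    using pos rad by (intro eventually_nhds_in_open) (auto simp: zero_ereal_def)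
  then have "\<forall>\<^sub>F z in nhds 0. eval_fps C z = G z"
    by eventually_elim (simp add: G_def)
  ultimately have "G analytic_on {0}"
    using analytic_at_cong by blast
  moreover have "\<forall>\<^sub>F x in nhds (0::real). x \<in> eball 0 (fps_conv_radius F)"
    using pos by (intro eventually_nhds_in_open) (auto simp: zero_ereal_def)
  then have "\<forall>\<^sub>F x in nhds 0. G (of_real x) = of_real (\<phi> x)"
    using assms[unfolded has_fps_expansion_def, THEN conjunct2]
  proof eventually_elim
    case (elim x)
    have "G (of_real x) = (\<Sum>n. of_real (fps_nth F n * x ^ n))"
      using elim rad by (simp add: eval_fps_def C_def G_def)
    also have "\<dots> = of_real (\<Sum>n. fps_nth F n * x ^ n)"
      by (rule suminf_of_real [symmetric], rule summable_fps) (use elim in simp)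
    finally show ?case using elim by (simp add: eval_fps_def)
  qed
  moreover have "G (cnj z) = cnj (G z)" for z
  proof (cases "ereal (norm z) < fps_conv_radius C")
    case True
    have "(\<lambda>n. cnj (fps_nth C n * z ^ n)) sums cnj (eval_fps C z)"
      unfolding sums_cnj using True by (rule sums_eval_fps)
    moreover have "(\<lambda>n. cnj (fps_nth C n * z ^ n)) = (\<lambda>n. fps_nth C n * cnj z ^ n)"
      by (simp add: C_def)
    ultimately have "(\<lambda>n. fps_nth C n * cnj z ^ n) sums cnj (eval_fps C z)" by simp
    then show ?thesis using True by (simp add: G_def eval_fps_def sums_iff)
  qed (simp add: G_def)
  ultimately show ?thesis using that by blast
qed

text \<open>
  The converse passage: on the real line the real parts of the Taylor coefficients of the extension
  already sum to \<open>\<phi>\<close>. Together with \<open>analytic_germE\<close> this transfers to the real line those closure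
  properties that are easiest to see by holomorphy.
\<close>

lemma analytic_germ_if_complex_extension:
  assumes "G analytic_on {0}" "\<forall>\<^sub>F x in nhds 0. G (of_real x) = of_real (\<phi> x)"
  shows "analytic_germ \<phi>"
proof -
  have "G has_fps_expansion fps_expansion G 0"
    using assms(1) by (rule analytic_at_imp_has_fps_expansion_0)
  then have pos: "fps_conv_radius (fps_expansion G 0) > 0"
    and ev: "\<forall>\<^sub>F z in nhds 0. eval_fps (fps_expansion G 0) z = G z"
    by (auto simp: has_fps_expansion_def)
  define F where "F = Abs_fps (\<lambda>n. Re (fps_nth (fps_expansion G 0) n))"
  have lim: "((\<lambda>x::real. complex_of_real x) \<longlongrightarrow> 0) (nhds 0)"
    by (rule tendsto_eq_intros filterlim_ident refl | simp)+
  have ev': "\<forall>\<^sub>F x in nhds (0::real). eval_fps (fps_expansion G 0) (of_real x) = G (of_real x)"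
    using ev lim by (auto simp: filterlim_iff)
  have "\<forall>\<^sub>F x in nhds (0::real). x \<in> eball 0 (fps_conv_radius (fps_expansion G 0))"
    using pos by (intro eventually_nhds_in_open) (auto simp: zero_ereal_def)
  then have "\<forall>\<^sub>F x in nhds 0. (\<lambda>n. fps_nth F n * x ^ n) sums \<phi> x"
    using assms(2) ev'
  proof eventually_elim
    case (elim x)
    have "(\<lambda>n. fps_nth (fps_expansion G 0) n * of_real x ^ n) sums
        eval_fps (fps_expansion G 0) (of_real x)"
      using elim(1) by (intro sums_eval_fps) simp
    then have "(\<lambda>n. fps_nth (fps_expansion G 0) n * of_real x ^ n) sums of_real (\<phi> x)"
      using elim(2,3) by simp
    then have "(\<lambda>n. Re (fps_nth (fps_expansion G 0) n * of_real x ^ n)) sums Re (of_real (\<phi> x))"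
      by (rule sums_Re)
    then show ?case by (simp add: F_def flip: of_real_power)
  qed
  then have "\<phi> has_fps_expansion F" by (rule has_fps_expansionI)
  then show ?thesis unfolding analytic_germ_def by blast
qed

lemma analytic_germE:
  assumes "analytic_germ \<phi>"
  obtains G :: "complex \<Rightarrow> complex" where "G analytic_on {0}"
    "\<forall>\<^sub>F x in nhds 0. G (of_real x) = of_real (\<phi> x)" "\<And>z. G (cnj z) = cnj (G z)"
    "G 0 = of_real (\<phi> 0)"
proof -
  obtain F where "\<phi> has_fps_expansion F" using assms by (auto simp: analytic_germ_def)
  then obtain G :: "complex \<Rightarrow> complex" where "G analytic_on {0}"
    "\<forall>\<^sub>F x in nhds 0. G (of_real x) = of_real (\<phi> x)" "\<And>z. G (cnj z) = cnj (G z)"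
    using fps_expansion_extends_holomorphically by blast
  moreover from this(2) have "G 0 = of_real (\<phi> 0)"
    by (auto dest: eventually_nhds_x_imp_x)
  ultimately show ?thesis using that by blast
qed

lemma analytic_germ_const [intro]: "analytic_germ (\<lambda>_. c)"
  and analytic_germ_ident [intro]: "analytic_germ (\<lambda>x. x)"
  and analytic_germ_add [intro]: "analytic_germ \<phi> \<Longrightarrow> analytic_germ \<psi> \<Longrightarrow> analytic_germ (\<lambda>x. \<phi> x + \<psi> x)"
  and analytic_germ_diff [intro]: "analytic_germ \<phi> \<Longrightarrow> analytic_germ \<psi> \<Longrightarrow> analytic_germ (\<lambda>x. \<phi> x - \<psi> x)"
  and analytic_germ_mult [intro]: "analytic_germ \<phi> \<Longrightarrow> analytic_germ \<psi> \<Longrightarrow> analytic_germ (\<lambda>x. \<phi> x * \<psi> x)"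
  and analytic_germ_minus [intro]: "analytic_germ \<phi> \<Longrightarrow> analytic_germ (\<lambda>x. - \<phi> x)"
  and analytic_germ_deriv [intro]: "analytic_germ \<phi> \<Longrightarrow> analytic_germ (deriv \<phi>)"
  unfolding analytic_germ_def by (blast intro: fps_expansion_intros)+

lemma analytic_germ_cong:
  assumes "analytic_germ \<phi>" "\<forall>\<^sub>F x in nhds 0. \<phi> x = \<psi> x"
  shows "analytic_germ \<psi>"
  using assms has_fps_expansion_cong unfolding analytic_germ_def by blast

lemma eventually_nhds_0_compose:
  fixes \<psi> :: "real \<Rightarrow> real"
  assumes "isCont \<psi> 0" "\<psi> 0 = 0" "\<forall>\<^sub>F x in nhds 0. P x"
  shows "\<forall>\<^sub>F x in nhds 0. P (\<psi> x)"
proof -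
  have "filterlim \<psi> (nhds 0) (nhds 0)"
    using assms(1,2) by (metis isCont_def tendsto_at_iff_tendsto_nhds)
  then show ?thesis using assms(3) by (auto simp: filterlim_iff)
qed

lemma analytic_germ_isCont: "analytic_germ \<phi> \<Longrightarrow> isCont \<phi> 0"
  unfolding analytic_germ_def using has_fps_expansion_imp_continuous by blast

lemma analytic_germ_differentiable:
  assumes "analytic_germ \<phi>"
  shows "\<forall>\<^sub>F x in nhds 0. (\<phi> has_real_derivative deriv \<phi> x) (at x)"
proof -
  obtain F where F: "\<phi> has_fps_expansion F" using assms by (auto simp: analytic_germ_def)
  then have "\<forall>\<^sub>F x in nhds 0. \<forall>\<^sub>F t in nhds x. eval_fps F t = \<phi> t"
    by (simp add: has_fps_expansion_def eventually_eventually)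
  moreover have "\<forall>\<^sub>F x in nhds 0. x \<in> eball 0 (fps_conv_radius F)"
    using F by (intro eventually_nhds_in_open) (auto simp: has_fps_expansion_def zero_ereal_def)
  ultimately show ?thesis
  proof eventually_elim
    case (elim x)
    have "(eval_fps F has_real_derivative eval_fps (fps_deriv F) x) (at x)"
      using elim(2) by (intro has_field_derivative_eval_fps) simp
    then have "(\<phi> has_real_derivative eval_fps (fps_deriv F) x) (at x)"
      using DERIV_cong_ev[OF refl elim(1) refl] by simp
    then show ?case using DERIV_imp_deriv by metis
  qed
qed

lemma analytic_germ_eventually_pos:
  assumes "analytic_germ \<phi>" "\<phi> 0 > 0"
  shows "\<forall>\<^sub>F x in nhds 0. \<phi> x > 0"
  using analytic_germ_isCont[OF assms(1)] assms(2)
  by (metis isCont_def order_tendstoD(1) tendsto_at_iff_tendsto_nhds)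

lemma analytic_germ_derivative_at_0:
  assumes "analytic_germ \<phi>"
  shows "(\<phi> has_real_derivative deriv \<phi> 0) (at 0)"
  using analytic_germ_differentiable[OF assms] by (rule eventually_nhds_x_imp_x)

lemma analytic_germ_compose:
  assumes "analytic_germ \<phi>" "analytic_germ \<psi>" "\<psi> 0 = 0"
  shows "analytic_germ (\<lambda>x. \<phi> (\<psi> x))"
proof -
  obtain G where G: "G analytic_on {0}" "\<forall>\<^sub>F x in nhds 0. G (of_real x) = of_real (\<phi> x)"
    using assms(1) by (rule analytic_germE) blast
  obtain H where H: "H analytic_on {0}" "\<forall>\<^sub>F x in nhds 0. H (of_real x) = of_real (\<psi> x)"
      "H 0 = of_real (\<psi> 0)"
    using assms(2) by (rule analytic_germE) blast
  have "G \<circ> H analytic_on {0}"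
    by (rule analytic_on_compose_gen[OF H(1) G(1)]) (use H(3) assms(3) in auto)
  moreover have "\<forall>\<^sub>F x in nhds 0. G (of_real (\<psi> x)) = of_real (\<phi> (\<psi> x))"
    using eventually_nhds_0_compose[OF analytic_germ_isCont[OF assms(2)] assms(3) G(2)] .
  then have "\<forall>\<^sub>F x in nhds 0. (G \<circ> H) (of_real x) = of_real (\<phi> (\<psi> x))"
    using H(2) by eventually_elim simp
  ultimately show ?thesis by (rule analytic_germ_if_complex_extension)
qed

lemma analytic_germ_exp:
  assumes "analytic_germ \<psi>"
  shows "analytic_germ (\<lambda>x. exp (\<psi> x))"
proof -
  obtain H where H: "H analytic_on {0}" "\<forall>\<^sub>F x in nhds 0. H (of_real x) = of_real (\<psi> x)"
    using assms by (rule analytic_germE) blast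
  show ?thesis
  proof (rule analytic_germ_if_complex_extension)
    show "(\<lambda>z. exp (H z)) analytic_on {0}"
      using H(1) by (intro analytic_intros)
    show "\<forall>\<^sub>F x in nhds 0. exp (H (of_real x)) = of_real (exp (\<psi> x))"
      using H(2) by eventually_elim (simp add: exp_of_real)
  qed
qed

lemma analytic_germ_sqrt:
  assumes "analytic_germ \<psi>" "\<psi> 0 > 0"
  shows "analytic_germ (\<lambda>x. sqrt (\<psi> x))"
proof -
  obtain H where H: "H analytic_on {0}" "\<forall>\<^sub>F x in nhds 0. H (of_real x) = of_real (\<psi> x)"
      "H 0 = of_real (\<psi> 0)"
    using assms(1) by (rule analytic_germE) blast
  have "\<forall>\<^sub>F x in nhds 0. \<psi> x > 0"
    using assms by (rule analytic_germ_eventually_pos)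
  show ?thesis
  proof (rule analytic_germ_if_complex_extension)
    show "(\<lambda>z. csqrt (H z)) analytic_on {0}"
      using H(1,3) assms(2) by (intro analytic_intros) (auto simp: complex_nonpos_Reals_iff)
    show "\<forall>\<^sub>F x in nhds 0. csqrt (H (of_real x)) = of_real (sqrt (\<psi> x))"
      using H(2) \<open>\<forall>\<^sub>F x in nhds 0. \<psi> x > 0\<close> by eventually_elim simp
  qed
qed

lemma real_derivative_of_complex_extension:
  assumes "(G has_field_derivative D) (at (of_real x))"
    and "\<forall>\<^sub>F t in nhds x. Re (G (of_real t)) = \<phi> t"
  shows "(\<phi> has_real_derivative Re D) (at x)"
proof -
  have "((\<lambda>t. G (of_real t)) has_vector_derivative D) (at x)"
    using has_vector_derivative_real_field[OF assms(1)] .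
  then have "((\<lambda>t. Re (G (of_real t))) has_real_derivative Re D) (at x)"
    by (auto simp: has_vector_derivative_complex_iff)
  then show ?thesis
    using DERIV_cong_ev[OF refl assms(2) refl] by blast
qed

text \<open>
  A complex primitive of the extension has constant imaginary part along the real line, since its
  derivative is real there; after subtracting its value at \<open>0\<close> it is real on reals.
\<close>

lemma analytic_germ_primitive:
  assumes "analytic_germ \<phi>"
  obtains \<Phi> where "analytic_germ \<Phi>" "\<Phi> 0 = 0"
    "\<forall>\<^sub>F x in nhds 0. (\<Phi> has_real_derivative \<phi> x) (at x)"
proof -
  obtain H where H: "H analytic_on {0}" "\<forall>\<^sub>F x in nhds 0. H (of_real x) = of_real (\<phi> x)"
      "\<And>z. H (cnj z) = cnj (H z)"
    using assms by (rule analytic_germE) blast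
  obtain r where r: "r > 0" "H holomorphic_on ball 0 r"
    using H(1) by (auto simp: analytic_on_def)
  obtain G0 where G0: "\<And>z. z \<in> ball 0 r \<Longrightarrow> (G0 has_field_derivative H z) (at z within ball 0 r)"
    using holomorphic_convex_primitive'[OF _ _ r(2)] by auto
  have G0': "(G0 has_field_derivative H z) (at z)" if "z \<in> ball 0 r" for z
    using G0[OF that] that by (simp add: at_within_open[OF that])
  define \<Phi> where "\<Phi> x = Re (G0 (of_real x)) - Re (G0 0)" for x
  have der: "(\<Phi> has_real_derivative Re (H (of_real x))) (at x)" if "\<bar>x\<bar> < r" for x
  proof -
    have "((\<lambda>z. G0 z - G0 0) has_field_derivative H (of_real x)) (at (of_real x))"
      using G0'[of "of_real x"] that by (auto intro!: derivative_eq_intros)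
    then show ?thesis
      by (rule real_derivative_of_complex_extension) (simp add: \<Phi>_def)
  qed
  have Im0: "Im (H (of_real x)) = 0" for x
    using H(3)[of "of_real x"] by (simp add: complex_eq_iff)
  have im: "Im (G0 (of_real x)) = Im (G0 0)" if "\<bar>x\<bar> < r" for x
  proof -
    have d: "((\<lambda>t. Im (G0 (of_real t))) has_real_derivative 0) (at t)" if "\<bar>t\<bar> < r" for t
    proof -
      have "((\<lambda>t. G0 (of_real t)) has_vector_derivative H (of_real t)) (at t)"
        using has_vector_derivative_real_field[OF G0'[of "of_real t"]] that by simp
      then show ?thesis using Im0 by (auto simp: has_vector_derivative_complex_iff)
    qed
    have "\<exists>c. \<forall>t\<in>{-r<..<r}. Im (G0 (of_real t)) = c"
    proof (rule has_field_derivative_zero_constant)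
      show "((\<lambda>t. Im (G0 (of_real t))) has_real_derivative 0) (at t within {-r<..<r})"
        if "t \<in> {-r<..<r}" for t
        using d[of t] that has_field_derivative_at_within by (simp add: abs_less_iff)
    qed simp
    then obtain c where "\<forall>t\<in>{-r<..<r}. Im (G0 (of_real t)) = c" by blast
    from this[rule_format, of 0] this[rule_format, of x] that r(1) show ?thesis
      by (simp add: abs_less_iff)
  qed
  have near: "\<forall>\<^sub>F x in nhds (0::real). x \<in> {-r<..<r}"
    using r(1) by (intro eventually_nhds_in_open) auto
  show ?thesis
  proof (rule that)
    show "analytic_germ \<Phi>"
    proof (rule analytic_germ_if_complex_extension)
      have "G0 holomorphic_on ball 0 r"
        unfolding holomorphic_on_def field_differentiable_def using G0 by blast
      then have "G0 analytic_on {0}" using r(1) analytic_at_ball by blast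
      then show "(\<lambda>z. G0 z - G0 0) analytic_on {0}" by (intro analytic_intros)
      show "\<forall>\<^sub>F x in nhds 0. G0 (of_real x) - G0 0 = of_real (\<Phi> x)"
        using near by eventually_elim (auto simp: \<Phi>_def complex_eq_iff im abs_less_iff)
    qed
    show "\<Phi> 0 = 0" by (simp add: \<Phi>_def)
    show "\<forall>\<^sub>F x in nhds 0. (\<Phi> has_real_derivative \<phi> x) (at x)"
      using near H(2)
    proof eventually_elim
      case (elim x)
      then show ?case using der[of x] by (auto simp: abs_less_iff)
    qed
  qed
qed

text \<open>
  The inverse function theorem for holomorphic functions gives a local inverse of the extension. It
  maps reals to reals: if \<open>H z\<close> is real, then \<open>H\<close> takes the same value at \<open>z\<close> and at its conjugate,
  and injectivity makes \<open>z\<close> real.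
\<close>

lemma analytic_germ_right_inverse:
  assumes "analytic_germ \<phi>" "\<phi> 0 = 0" "deriv \<phi> 0 \<noteq> 0"
  obtains \<psi> where "analytic_germ \<psi>" "\<psi> 0 = 0" "\<forall>\<^sub>F x in nhds 0. \<phi> (\<psi> x) = x"
proof -
  obtain H where H: "H analytic_on {0}" "\<forall>\<^sub>F x in nhds 0. H (of_real x) = of_real (\<phi> x)"
      "\<And>z. H (cnj z) = cnj (H z)" "H 0 = of_real (\<phi> 0)"
    using assms(1) by (rule analytic_germE) blast
  obtain r0 where r0: "r0 > 0" "H holomorphic_on ball 0 r0"
    using H(1) by (auto simp: analytic_on_def)
  have dH: "(H has_field_derivative deriv H 0) (at 0)"
    using r0 by (metis DERIV_deriv_iff_field_differentiable centre_in_ball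
        holomorphic_on_imp_differentiable_at open_ball)
  have "(\<phi> has_real_derivative Re (deriv H 0)) (at 0)"
    by (rule real_derivative_of_complex_extension[where G = H])
      (use dH H(2) in \<open>auto elim: eventually_mono\<close>)
  then have ne: "deriv H 0 \<noteq> 0" using assms(3) DERIV_imp_deriv by fastforce
  have mem: "0 \<in> ball (0::complex) r0" using r0(1) by simp
  obtain r1 where r1: "r1 > 0" "ball (0::complex) r1 \<subseteq> ball 0 r0" "inj_on H (ball 0 r1)"
    by (rule has_complex_derivative_locally_injective[OF r0(2) mem open_ball ne])
  have holo: "H holomorphic_on ball 0 r1" using r0(2) r1(2) holomorphic_on_subset by blast
  obtain Y where Y: "Y holomorphic_on (H ` ball 0 r1)"
      "\<And>z. z \<in> ball 0 r1 \<Longrightarrow> Y (H z) = z"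
    using holomorphic_has_inverse[OF holo open_ball r1(3)] by metis
  have opn: "open (H ` ball 0 r1)"
    by (rule open_mapping_thm3[OF holo open_ball r1(3)])
  have H0: "H 0 = 0" using H(4) assms(2) by simp
  have Y0: "Y 0 = 0" using Y(2)[of 0] r1(1) H0 by simp
  have 0: "0 \<in> H ` ball 0 r1" using H0 r1(1) by force
  define \<psi> where "\<psi> x = Re (Y (of_real x))" for x
  have real: "Y (of_real x) = of_real (\<psi> x) \<and> H (of_real (\<psi> x)) = of_real x"
    if x: "of_real x \<in> H ` ball 0 r1" for x
  proof -
    obtain z where z: "z \<in> ball 0 r1" "H z = of_real x" using x by auto
    have "H (cnj z) = H z" using H(3) z(2) by simp
    then have "cnj z = z" by (rule inj_onD[OF r1(3)]) (use z(1) in auto)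
    then have "z = of_real (Re z)" by (simp add: complex_eq_iff)
    moreover have "Y (of_real x) = z" using Y(2)[OF z(1)] z(2) by simp
    ultimately show ?thesis using z by (simp add: \<psi>_def)
  qed
  have lim: "((\<lambda>x::real. complex_of_real x) \<longlongrightarrow> 0) (nhds 0)"
    by (rule tendsto_eq_intros filterlim_ident refl | simp)+
  have near: "\<forall>\<^sub>F x in nhds (0::real). of_real x \<in> H ` ball 0 r1"
    using lim eventually_nhds_in_open[OF opn 0] by (auto simp: filterlim_iff)
  have germ: "analytic_germ \<psi>"
  proof (rule analytic_germ_if_complex_extension)
    show "Y analytic_on {0}"
      using Y(1) opn 0 analytic_at by blast
    show "\<forall>\<^sub>F x in nhds 0. Y (of_real x) = of_real (\<psi> x)"
      using near by eventually_elim (use real in blast)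
  qed
  have \<psi>0: "\<psi> 0 = 0" by (simp add: \<psi>_def Y0)
  have "\<forall>\<^sub>F x in nhds 0. H (of_real (\<psi> x)) = of_real (\<phi> (\<psi> x))"
    using eventually_nhds_0_compose[OF analytic_germ_isCont[OF germ] \<psi>0 H(2)] .
  then have "\<forall>\<^sub>F x in nhds 0. \<phi> (\<psi> x) = x"
    using near by eventually_elim (use real in fastforce)
  then show ?thesis using that germ \<psi>0 by blast
qed

text \<open>
  The extension is holomorphic on a full disc around \<open>0\<close>, so it can be expanded about each real
  point of that disc.
\<close>

lemma analytic_germ_imp_real_analytic_on:
  assumes "analytic_germ \<phi>"
  obtains r where "r > 0" "real_analytic_on \<phi> {-r<..<r}"
proof -
  obtain G where G: "G analytic_on {0}" "\<forall>\<^sub>F x in nhds 0. G (of_real x) = of_real (\<phi> x)"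
    using assms by (rule analytic_germE) blast
  obtain r1 where r1: "r1 > 0" "G holomorphic_on ball 0 r1"
    using G(1) by (auto simp: analytic_on_def)
  obtain r2 where r2: "r2 > 0" "\<And>x. \<bar>x\<bar> < r2 \<Longrightarrow> G (of_real x) = of_real (\<phi> x)"
    using G(2) unfolding eventually_nhds_metric by (auto simp: dist_real_def)
  define r where "r = min r1 r2"
  have "analytic_germ (\<lambda>x. \<phi> (a + x))" if a: "a \<in> {-r<..<r}" for a
  proof (rule analytic_germ_if_complex_extension)
    have "G analytic_on ball 0 r1" using r1(2) by (simp add: analytic_on_open)
    then have "G analytic_on {of_real a}"
      by (rule analytic_on_subset) (use a in \<open>auto simp: r_def\<close>)
    moreover have "(\<lambda>z. of_real a + z) analytic_on {0}"
      by (intro analytic_on_add analytic_on_const analytic_on_ident)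
    ultimately have "G \<circ> (\<lambda>z. of_real a + z) analytic_on {0}"
      by (intro analytic_on_compose_gen[of "\<lambda>z. of_real a + z" "{0}" G "{of_real a}"]) simp_all
    then show "(\<lambda>z. G (of_real a + z)) analytic_on {0}" by (simp add: o_def)
    have "\<forall>\<^sub>F x in nhds (0::real). x \<in> {-r-a<..<r-a}"
      using a by (intro eventually_nhds_in_open) auto
    then show "\<forall>\<^sub>F x in nhds 0. G (of_real a + of_real x) = of_real (\<phi> (a + x))"
    proof eventually_elim
      case (elim x)
      then have "- r < a + x" "a + x < r" "r \<le> r2" by (auto simp: r_def)
      then show ?case using r2(2)[of "a + x"] by (simp add: abs_less_iff)
    qed
  qed
  then show ?thesis
    using that[of r] r1(1) r2(1) by (auto simp: r_def real_analytic_on_def analytic_germ_def)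
qed

text \<open>
  A nonzero series is a power of \<open>x\<close> times a function that is continuous and nonzero at \<open>0\<close>.
\<close>

lemma analytic_germ_zero_isolated:
  assumes "analytic_germ \<phi>" "\<not> (\<forall>\<^sub>F x in nhds 0. \<phi> x = 0)"
  shows "\<forall>\<^sub>F x in at 0. \<phi> x \<noteq> 0"
proof -
  obtain F where F: "\<phi> has_fps_expansion F" using assms by (auto simp: analytic_germ_def)
  have "F \<noteq> 0" using F assms(2) by (auto simp: has_fps_expansion_0_iff)
  define n where "n = subdegree F"
  define \<psi> where "\<psi> x = (if x = 0 then fps_nth F n else \<phi> x / x ^ n)" for x
  have "\<psi> has_fps_expansion fps_shift n F"
    unfolding \<psi>_def by (rule has_fps_expansion_shift[OF F]) (simp_all add: n_def)
  then have "isCont \<psi> 0" using has_fps_expansion_imp_continuous by blast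
  moreover have "\<psi> 0 \<noteq> 0" using \<open>F \<noteq> 0\<close> by (simp add: \<psi>_def n_def)
  ultimately have "\<forall>\<^sub>F x in at 0. \<psi> x \<noteq> 0"
    using tendsto_imp_eventually_ne unfolding isCont_def by blast
  moreover have "\<forall>\<^sub>F x::real in at 0. x \<noteq> 0" by (simp add: eventually_at_filter)
  ultimately show ?thesis by eventually_elim (auto simp: \<psi>_def)
qed

lemma analytic_germ_divide_ident:
  assumes "analytic_germ \<phi>" "\<phi> 0 = 0"
  obtains \<psi> where "analytic_germ \<psi>" "\<forall>x. \<phi> x = x * \<psi> x"
proof -
  obtain F where F: "\<phi> has_fps_expansion F" using assms by (auto simp: analytic_germ_def)
  have "fps_nth F 0 = 0" using has_fps_expansion_at_0[OF F] assms(2) by simp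
  show ?thesis
  proof (cases "F = 0")
    case True
    then have ev: "\<forall>\<^sub>F x in nhds 0. \<phi> x = 0" using F by (simp add: has_fps_expansion_0_iff)
    show ?thesis
    proof (rule that)
      \<comment> \<open>at \<open>0\<close> the quotient is \<open>0\<close> by convention, which continues the zero germ\<close>
      show "analytic_germ (\<lambda>x. \<phi> x / x)"
        by (rule analytic_germ_cong[OF analytic_germ_const[of 0]])
          (rule eventually_mono[OF ev], simp)
    qed (use assms(2) in auto)
  next
    case False
    then have "1 \<le> subdegree F" using \<open>fps_nth F 0 = 0\<close> subdegree_eq_0_iff[of F] by linarith
    then have "(\<lambda>x. if x = 0 then fps_nth F 1 else \<phi> x / x ^ 1) has_fps_expansion fps_shift 1 F"
      by (intro has_fps_expansion_shift[OF F]) auto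
    then show ?thesis using assms(2)
      by (intro that[of "\<lambda>x. if x = 0 then fps_nth F 1 else \<phi> x / x ^ 1"])
        (auto simp: analytic_germ_def)
  qed
qed

lemma odd_analytic_near_0_iff:
  "odd_analytic_near_0 h \<longleftrightarrow> analytic_germ h \<and> (\<forall>\<^sub>F x in nhds 0. h (- x) = - h x)"
proof
  assume "odd_analytic_near_0 h"
  then obtain r where r: "r > 0" "real_analytic_on h {-r<..<r}" "\<forall>x\<in>{-r<..<r}. h (- x) = - h x"
    by (auto simp: odd_analytic_near_0_def)
  have "0 \<in> {-r<..<r}" using r(1) by simp
  then have "\<exists>F. (\<lambda>x. h (0 + x)) has_fps_expansion F"
    using r(2) unfolding real_analytic_on_def by blast
  then have "analytic_germ h" by (simp add: analytic_germ_def)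
  moreover have "\<forall>\<^sub>F x in nhds 0. x \<in> {-r<..<r}"
    using r(1) by (intro eventually_nhds_in_open) auto
  then have "\<forall>\<^sub>F x in nhds 0. h (- x) = - h x"
    by eventually_elim (use r(3) in blast)
  ultimately show "analytic_germ h \<and> (\<forall>\<^sub>F x in nhds 0. h (- x) = - h x)" ..
next
  assume h: "analytic_germ h \<and> (\<forall>\<^sub>F x in nhds 0. h (- x) = - h x)"
  then obtain r where r: "r > 0" "real_analytic_on h {-r<..<r}"
    using analytic_germ_imp_real_analytic_on by blast
  obtain d where d: "d > 0" "\<And>x. \<bar>x\<bar> < d \<Longrightarrow> h (- x) = - h x"
    using h unfolding eventually_nhds_metric by (auto simp: dist_real_def)
  have "real_analytic_on h {- min r d<..<min r d}"
    using r(2) by (auto simp: real_analytic_on_def)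
  moreover have "\<forall>x\<in>{- min r d<..<min r d}. h (- x) = - h x"
    by (intro ballI d(2)) (auto simp: abs_less_iff)
  ultimately show "odd_analytic_near_0 h"
    using r(1) d(1) unfolding odd_analytic_near_0_def by (intro exI[of _ "min r d"]) simp
qed

section \<open>The recursions on formal power series\<close>

lemma has_fps_expansion_higher_deriv:
  assumes "\<phi> has_fps_expansion F"
  shows "(deriv ^^ n) \<phi> has_fps_expansion (fps_deriv ^^ n) F"
  by (induction n) (simp_all add: assms has_fps_expansion_deriv)

lemma taylor_fps_eqI:
  assumes "\<phi> has_fps_expansion F"
  shows "taylor_fps \<phi> = F"
proof -
  have "(deriv ^^ n) \<phi> 0 = fps_nth F n * fact n" for n
    using has_fps_expansion_at_0[OF has_fps_expansion_higher_deriv[OF assms]]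
    by (simp add: fps_0th_higher_deriv)
  then show ?thesis by (simp add: taylor_fps_def fps_eq_iff)
qed

text \<open>
  The recursions defining \<^const>\<open>P_hat\<close> and, below, \<^const>\<open>Q_hat\<close>, acting on Taylor series instead of
  functions. All conditions at \<open>0\<close> are about constant coefficients of these series.
\<close>

primrec P_fps :: "real fps \<Rightarrow> nat \<Rightarrow> real fps" where
  "P_fps H 0 = fps_X"
| "P_fps H (Suc k) = fps_deriv (P_fps H k) * (1 + H)
     - fps_const (2 * real (Suc k) - 1) * P_fps H k * fps_deriv H"

primrec Q_fps :: "real fps \<Rightarrow> real fps \<Rightarrow> nat \<Rightarrow> real fps" where
  "Q_fps F G 0 = G"
| "Q_fps F G (Suc k) = fps_deriv (Q_fps F G k) - fps_const (real (Suc k) - 2) * F * Q_fps F G k"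

lemma P_hat_has_fps_expansion:
  assumes "h has_fps_expansion H"
  shows "P_hat h k has_fps_expansion P_fps H k"
proof (induction k)
  case 0
  show ?case by (simp add: has_fps_expansion_fps_X)
next
  case (Suc k)
  then show ?case
    unfolding P_hat.simps P_fps.simps
    by (intro fps_expansion_intros assms)
qed

lemma Q_hat_has_fps_expansion:
  assumes "f has_fps_expansion F" "g has_fps_expansion G"
  shows "Q_hat f g k has_fps_expansion Q_fps F G k"
proof (induction k)
  case 0
  show ?case by (simp add: assms)
next
  case (Suc k)
  then show ?case
    unfolding Q_hat.simps Q_fps.simps
    by (intro fps_expansion_intros assms)
qed

lemma analytic_germ_P_hat: "analytic_germ h \<Longrightarrow> analytic_germ (P_hat h k)"
  unfolding analytic_germ_def using P_hat_has_fps_expansion by blast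

lemma analytic_germ_Q_hat:
  "analytic_germ f \<Longrightarrow> analytic_germ g \<Longrightarrow> analytic_germ (Q_hat f g k)"
  unfolding analytic_germ_def using Q_hat_has_fps_expansion by blast


section \<open>Truncated expansions\<close>

lemma coeff_truncated_expansion:
  assumes "\<phi> has_fps_expansion F"
  shows "coeff (truncated_expansion n \<phi>) i = (if i \<le> n then fps_nth F i else 0)"
  by (simp add: truncated_expansion_def taylor_fps_eqI[OF assms] coeff_truncate_fps less_Suc_eq_le)

text \<open>
  Accuracy is lost only by differentiation: the coefficient of order \<open>i\<close> of step \<open>k + 1\<close> involves the
  coefficients of \<open>P\<^sub>k\<close> up to order \<open>i + 1\<close> and those of \<open>h\<close> up to order \<open>i + 1\<close>. Both are still exact
  when \<open>i \<le> M - (k + 1)\<close>.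
\<close>

lemma coeff_P_trunc:
  assumes "h has_fps_expansion H" "k \<le> M"
  shows "coeff (P_trunc M h k) i = (if i \<le> M - k then fps_nth (P_fps H k) i else 0)"
  using assms(2)
proof (induction k arbitrary: i)
  case 0
  have "coeff [:0, 1::real:] i = (if i = 1 then 1 else 0)"
    by (simp add: coeff_pCons split: nat.split)
  then show ?case by (auto simp: coeff_poly_cutoff)
next
  case (Suc k)
  let ?T = "truncated_expansion M h"
  note T = coeff_truncated_expansion[OF assms(1), of M]
  have "coeff (pderiv (P_trunc M h k) * (1 + ?T) - smult (2 * real (Suc k) - 1) (P_trunc M h k * pderiv ?T)) i
      = fps_nth (P_fps H (Suc k)) i" if i: "i \<le> M - Suc k"
  proof -
    have "coeff (pderiv (P_trunc M h k) * (1 + ?T)) i = fps_nth (fps_deriv (P_fps H k) * (1 + H)) i"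
      unfolding coeff_mult fps_mult_nth atLeast0AtMost
      using i Suc.prems
      by (intro sum.cong refl) (auto simp: coeff_pderiv T Suc.IH coeff_1)
    moreover have "coeff (P_trunc M h k * pderiv ?T) i = fps_nth (P_fps H k * fps_deriv H) i"
      unfolding coeff_mult fps_mult_nth atLeast0AtMost
      using i Suc.prems
      by (intro sum.cong refl) (auto simp: coeff_pderiv T Suc.IH)
    ultimately show ?thesis by (simp add: mult.assoc)
  qed
  then show ?case by (auto simp: Let_def coeff_poly_cutoff less_Suc_eq_le)
qed

lemma coeff_Q_trunc:
  assumes "f has_fps_expansion F" "g has_fps_expansion G" "k \<le> M"
  shows "coeff (Q_trunc M f g k) i = (if i \<le> M - k then fps_nth (Q_fps F G k) i else 0)"
  using assms(3)
proof (induction k arbitrary: i)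
  case 0
  show ?case by (simp add: coeff_truncated_expansion[OF assms(2)])
next
  case (Suc k)
  let ?T = "truncated_expansion M f"
  note T = coeff_truncated_expansion[OF assms(1), of M]
  have "coeff (pderiv (Q_trunc M f g k) - smult (real (Suc k) - 2) (?T * Q_trunc M f g k)) i
      = fps_nth (Q_fps F G (Suc k)) i" if i: "i \<le> M - Suc k"
  proof -
    have "coeff (pderiv (Q_trunc M f g k)) i = fps_nth (fps_deriv (Q_fps F G k)) i"
      using i Suc.prems by (auto simp: coeff_pderiv Suc.IH)
    moreover have "coeff (?T * Q_trunc M f g k) i = fps_nth (F * Q_fps F G k) i"
      unfolding coeff_mult fps_mult_nth atLeast0AtMost
      using i Suc.prems by (intro sum.cong refl) (auto simp: T Suc.IH)
    ultimately show ?thesis by (simp add: mult.assoc)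
  qed
  then show ?case by (auto simp: Let_def coeff_poly_cutoff less_Suc_eq_le)
qed


section \<open>Determination of a germ by its necessary conditions\<close>

text \<open>
  The coefficient \<open>c\<close> may vanish, so \<open>leading_term A m 0\<close> says that \<open>A\<close> has order greater than \<open>m\<close>.
\<close>

definition leading_term :: "real fps \<Rightarrow> nat \<Rightarrow> real \<Rightarrow> bool" where
  "leading_term A m c \<longleftrightarrow> (\<forall>i<m. fps_nth A i = 0) \<and> fps_nth A m = c"

lemma leading_term_add:
  "leading_term A m a \<Longrightarrow> leading_term B m b \<Longrightarrow> leading_term (A + B) m (a + b)"
  and leading_term_diff:
  "leading_term A m a \<Longrightarrow> leading_term B m b \<Longrightarrow> leading_term (A - B) m (a - b)"
  and leading_term_deriv:
  "leading_term A (Suc m) a \<Longrightarrow> leading_term (fps_deriv A) m (real (Suc m) * a)"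
  and leading_term_weaken:
  "leading_term A m a \<Longrightarrow> j < m \<Longrightarrow> leading_term A j 0"
  by (auto simp: leading_term_def)

lemma leading_term_mult:
  assumes "leading_term A m a"
  shows "leading_term (A * B) m (a * fps_nth B 0)"
proof -
  have "fps_nth (A * B) i = (if i < m then 0 else a * fps_nth B 0)" if "i \<le> m" for i
  proof -
    have "fps_nth (A * B) i = (\<Sum>j\<in>{0..i}. if j = m then a * fps_nth B 0 else 0)"
      unfolding fps_mult_nth using assms that
      by (intro sum.cong refl) (auto simp: leading_term_def)
    then show ?thesis using that by simp
  qed
  then show ?thesis by (simp add: leading_term_def)
qed

lemma leading_term_mult_right:
  assumes "leading_term A m a"
  shows "leading_term (B * A) m (fps_nth B 0 * a)"
  using leading_term_mult[OF assms, of B] by (simp add: mult.commute)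

text \<open>
  Let \<open>E = H - K\<close> have order \<open>n\<close> with leading coefficient \<open>\<delta>\<close>, and let \<open>D\<^sub>k\<close> be the difference of the
  two series \<open>P\<^sub>k\<close>. From \<open>D\<^sub>1 = E - X E'\<close> one gets the leading coefficient \<open>(1 - n) \<delta>\<close> at order \<open>n\<close>;
  then \<open>D\<^sub>2\<close> collects \<open>D\<^sub>1'\<close> and \<open>- 3 E'\<close>, which gives \<open>- n (n + 2) \<delta>\<close> at order \<open>n - 1\<close>. Every later
  step only differentiates the leading term: all other contributions have higher order. The factor
  \<open>1 - n\<close> may vanish, the factor \<open>- n (n + 2)\<close> cannot, which is why the claim starts at \<open>k = 2\<close>.
\<close>

lemma P_fps_diff_leading_term:
  assumes "leading_term (H - K) n \<delta>" "n \<ge> 1" "fps_nth H 0 = 0" "fps_nth K 0 = 0"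
    and "2 \<le> k" "k \<le> Suc n"
  shows "\<exists>c. c \<noteq> 0 \<and> leading_term (P_fps H k - P_fps K k) (Suc n - k) (c * \<delta>)"
proof -
  define D where "D j = P_fps H j - P_fps K j" for j
  define E where "E = H - K"
  note E = assms(1)[folded E_def]
  have E': "leading_term (fps_deriv E) (n - 1) (real n * \<delta>)"
    using leading_term_deriv[of E "n - 1" \<delta>] E assms(2) by simp
  have step: "D (Suc j) = fps_deriv (D j) * (1 + H) + fps_deriv (P_fps K j) * E
      - fps_const (2 * real (Suc j) - 1) * (D j * fps_deriv H + P_fps K j * fps_deriv E)" for j
    by (simp add: D_def E_def algebra_simps)
  have D1: "leading_term (D 1) n ((1 - real n) * \<delta>)"
  proof -
    have "D 1 = E - fps_X * fps_deriv E" by (simp add: D_def E_def algebra_simps)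
    then show ?thesis using E by (simp add: leading_term_def left_diff_distrib)
  qed
  show ?thesis
    using assms(5,6) unfolding D_def [symmetric]
  proof (induction k rule: nat_induct_at_least)
    case base
    have "leading_term (D (Suc 1)) (n - 1) (real n * ((1 - real n) * \<delta>) * fps_nth (1 + H) 0
       + fps_nth (fps_deriv (P_fps K 1)) 0 * 0
       - fps_nth (fps_const (2 * real (Suc 1) - 1)) 0 * (0 * fps_nth (fps_deriv H) 0 + fps_nth (P_fps K 1) 0 * (real n * \<delta>)))"
      unfolding step[of 1]
      using leading_term_deriv[of "D 1" "n - 1"] D1 assms(2) E E'
      by (intro leading_term_add leading_term_diff leading_term_mult leading_term_mult_right)
         (auto intro: leading_term_weaken)
    also have "real n * ((1 - real n) * \<delta>) * fps_nth (1 + H) 0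
       + fps_nth (fps_deriv (P_fps K 1)) 0 * 0
       - fps_nth (fps_const (2 * real (Suc 1) - 1)) 0 * (0 * fps_nth (fps_deriv H) 0 + fps_nth (P_fps K 1) 0 * (real n * \<delta>))
       = (- real n * (real n + 2)) * \<delta>"
      using assms(3,4) by (simp add: algebra_simps)
    finally have "leading_term (D 2) (Suc n - 2) ((- real n * (real n + 2)) * \<delta>)"
      by (simp add: numeral_2_eq_2)
    moreover have "- real n * (real n + 2) \<noteq> 0" using assms(2) by auto
    ultimately show ?case by blast
  next
    case (Suc k)
    then obtain c where c: "c \<noteq> 0" "leading_term (D k) (Suc n - k) (c * \<delta>)" by auto
    have [simp]: "Suc n - k = Suc (n - k)" using Suc by auto
    have "leading_term (D (Suc k)) (n - k) (real (Suc (n - k)) * (c * \<delta>) * fps_nth (1 + H) 0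
       + fps_nth (fps_deriv (P_fps K k)) 0 * 0
       - fps_nth (fps_const (2 * real (Suc k) - 1)) 0 * (0 * fps_nth (fps_deriv H) 0 + fps_nth (P_fps K k) 0 * 0))"
      unfolding step[of k]
      using leading_term_deriv[of "D k" "n - k"] c assms(2) Suc.hyps Suc.prems
        leading_term_weaken[OF E, of "n - k"] leading_term_weaken[OF E', of "n - k"]
        leading_term_weaken[OF c(2), of "n - k"]
      by (intro leading_term_add leading_term_diff leading_term_mult leading_term_mult_right) auto
    then have "leading_term (D (Suc k)) (Suc n - Suc k) (real (Suc (n - k)) * c * \<delta>)"
      using assms(3) by (simp add: mult.assoc)
    moreover have "real (Suc (n - k)) * c \<noteq> 0" using c by simp
    ultimately show ?case by blast
  qed
qed

text \<open>
  At the first order \<open>n\<close> where \<open>H\<close> and \<open>K\<close> differ, the previous lemma with \<open>k = n + 1\<close> makes the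
  constant coefficients of \<open>P\<^bsub>n+1\<^esub>\<close> differ.
\<close>

lemma P_fps_at_0_determines_series:
  assumes "\<And>k. fps_nth (P_fps H k) 0 = fps_nth (P_fps K k) 0"
    and "fps_nth H 0 = 0" "fps_nth K 0 = 0"
  shows "H = K"
proof (rule ccontr)
  assume "H \<noteq> K"
  define n where "n = subdegree (H - K)"
  have lead: "leading_term (H - K) n (fps_nth (H - K) n)"
    unfolding leading_term_def n_def using nth_less_subdegree_zero by blast
  have ne: "fps_nth (H - K) n \<noteq> 0"
    using \<open>H \<noteq> K\<close> unfolding n_def by (intro nth_subdegree_nonzero) simp
  then have "n \<ge> 1" using assms(2,3) by (cases n) auto
  then obtain c where "c \<noteq> 0" "leading_term (P_fps H (Suc n) - P_fps K (Suc n)) 0 (c * fps_nth (H - K) n)"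
    using P_fps_diff_leading_term[OF lead _ assms(2,3), of "Suc n"] by auto
  then show False using assms(1)[of "Suc n"] ne by (auto simp: leading_term_def)
qed

lemma P_hat_at_0_determines_germ:
  assumes "analytic_germ h" "analytic_germ k" "h 0 = 0" "k 0 = 0"
    and "\<And>n. P_hat h n 0 = P_hat k n 0"
  shows "\<forall>\<^sub>F x in nhds 0. h x = k x"
proof -
  obtain H K where H: "h has_fps_expansion H" and K: "k has_fps_expansion K"
    using assms(1,2) by (auto simp: analytic_germ_def)
  have "H = K"
  proof (rule P_fps_at_0_determines_series)
    show "fps_nth (P_fps H n) 0 = fps_nth (P_fps K n) 0" for n
      using assms(5)[of n] has_fps_expansion_at_0[OF P_hat_has_fps_expansion[OF H]]
        has_fps_expansion_at_0[OF P_hat_has_fps_expansion[OF K]] by simp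
    show "fps_nth H 0 = 0" "fps_nth K 0 = 0"
      using has_fps_expansion_at_0[OF H] has_fps_expansion_at_0[OF K] assms(3,4) by auto
  qed
  then have "\<forall>\<^sub>F x in nhds 0. eval_fps H x = h x" "\<forall>\<^sub>F x in nhds 0. eval_fps H x = k x"
    using H K by (auto simp: has_fps_expansion_def)
  then show ?thesis by eventually_elim simp
qed


section \<open>Clocks and least periods\<close>

lemma antiderivative_on_real_line:
  fixes \<rho> :: "real \<Rightarrow> real"
  assumes "continuous_on UNIV \<rho>"
  obtains \<tau> where "\<And>s. (\<tau> has_real_derivative \<rho> s) (at s)"
proof -
  define \<tau> where "\<tau> x = (if 0 \<le> x then integral {0..x} \<rho> else - integral {x..0} \<rho>)" for x
  have cont: "continuous_on S \<rho>" for S using assms continuous_on_subset by blast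
  then have int: "\<rho> integrable_on {a..b}" for a b by (rule integrable_continuous_real)
  have "(\<tau> has_real_derivative \<rho> s) (at s)" for s
  proof -
    \<comment> \<open>near \<open>s\<close> both cases are one integral from \<open>-N\<close>, up to a constant\<close>
    define N where "N = \<bar>s\<bar> + 1"
    have eq: "integral {-N..x} \<rho> - integral {-N..0} \<rho> = \<tau> x" if "x \<in> {-N<..<N}" for x
    proof (cases "0 \<le> x")
      case True
      then have "integral {-N..0} \<rho> + integral {0..x} \<rho> = integral {-N..x} \<rho>"
        by (intro Henstock_Kurzweil_Integration.integral_combine int) (auto simp: N_def)
      then show ?thesis using True by (simp add: \<tau>_def)
    next
      case False
      then have "integral {-N..x} \<rho> + integral {x..0} \<rho> = integral {-N..0} \<rho>"
        using that by (intro Henstock_Kurzweil_Integration.integral_combine int) auto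
      then show ?thesis using False by (simp add: \<tau>_def)
    qed
    have s: "s \<in> {-N<..<N}" by (auto simp: N_def)
    have "((\<lambda>x. integral {-N..x} \<rho>) has_real_derivative \<rho> s) (at s within {-N..N})"
      using s by (intro integral_has_real_derivative cont) auto
    moreover have "at s within {-N..N} = at s"
      using s by (intro at_within_interior) (auto simp: interior_atLeastAtMost_real)
    ultimately have "((\<lambda>x. integral {-N..x} \<rho>) has_real_derivative \<rho> s) (at s)" by simp
    then have "((\<lambda>x. integral {-N..x} \<rho> - integral {-N..0} \<rho>) has_real_derivative \<rho> s) (at s)"
      by (auto intro!: derivative_eq_intros)
    moreover have "\<forall>\<^sub>F x in nhds s. x \<in> {-N<..<N}"
      using s by (intro eventually_nhds_in_open) auto
    then have ev: "\<forall>\<^sub>F x in nhds s. integral {-N..x} \<rho> - integral {-N..0} \<rho> = \<tau> x"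
      by eventually_elim (use eq in blast)
    ultimately show ?thesis using DERIV_cong_ev[OF refl ev refl] by blast
  qed
  then show ?thesis using that by blast
qed

text \<open>
  If \<open>\<theta>\<close> is an angle moving with velocity \<open>1 / \<rho>(\<theta>)\<close>, then \<open>\<tau>\<close> is the time at which it takes a given
  value: time as a function of the angle is an integral, and the motion is obtained by inverting it.
  One revolution adds \<open>T\<close> to \<open>\<tau>\<close>, so \<open>\<tau>\<close> is unbounded in both directions and the motion is defined
  for all times.
\<close>

lemma periodic_clock_inverse:
  fixes \<tau> \<rho> :: "real \<Rightarrow> real"
  assumes der: "\<And>s. (\<tau> has_real_derivative \<rho> s) (at s)"
    and pos: "\<And>s. \<rho> s > 0" and per: "\<And>s. \<rho> (s + 2 * pi) = \<rho> s"
  defines "T \<equiv> \<tau> (2 * pi) - \<tau> 0"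
  obtains \<theta> where "T > 0" "\<And>s. \<tau> (s + 2 * pi) = \<tau> s + T"
    "\<And>t. \<tau> (\<theta> t) = t" "\<And>s. \<theta> (\<tau> s) = s" "strict_mono \<tau>"
    "\<And>t. (\<theta> has_real_derivative 1 / \<rho> (\<theta> t)) (at t)"
proof -
  have mono: "strict_mono \<tau>"
    unfolding strict_mono_def using DERIV_pos_imp_increasing der pos by metis
  have T: "T > 0" using strict_monoD[OF mono, of 0 "2 * pi"] by (simp add: T_def)
  have "((\<lambda>s. \<tau> (s + 2 * pi) - \<tau> s) has_real_derivative 0) (at s)" for s
    using DERIV_shift[of \<tau> "\<rho> (s + 2 * pi)" s "2 * pi"] der[of "s + 2 * pi"] der[of s] per[of s]
    by (auto intro!: derivative_eq_intros)
  then have "\<tau> (s + 2 * pi) - \<tau> s = \<tau> (0 + 2 * pi) - \<tau> 0" for s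
    using DERIV_isconst_all[of "\<lambda>s. \<tau> (s + 2 * pi) - \<tau> s" s 0] by blast
  then have shift: "\<tau> (s + 2 * pi) = \<tau> s + T" for s
    by (simp add: T_def algebra_simps)
  have up: "\<tau> (s + real n * (2 * pi)) = \<tau> s + real n * T" for n s
  proof (induction n)
    case (Suc n)
    have "\<tau> (s + real (Suc n) * (2 * pi)) = \<tau> (s + real n * (2 * pi) + 2 * pi)"
      by (simp add: algebra_simps)
    also have "\<dots> = \<tau> s + real n * T + T" by (simp only: shift Suc)
    finally show ?case by (simp add: algebra_simps)
  qed simp
  have cont: "isCont \<tau> s" for s using der DERIV_isCont by blast
  have ex: "\<exists>s. \<tau> s = t" for t
  proof -
    obtain n :: nat where n: "real n > \<bar>t - \<tau> 0\<bar> / T" using reals_Archimedean2 by blast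
    then have n: "real n * T > \<bar>t - \<tau> 0\<bar>" using T by (simp add: field_simps)
    have "\<tau> (0 + real n * (2 * pi)) \<ge> t" using up[of 0 n] n by simp
    moreover have "\<tau> (- (real n * (2 * pi))) \<le> t" using up[of "- (real n * (2 * pi))" n] n by simp
    ultimately show ?thesis
      using IVT[of \<tau> "- (real n * (2 * pi))" t "real n * (2 * pi)"] cont by auto
  qed
  define \<theta> where "\<theta> = inv \<tau>"
  have inj: "inj \<tau>" using mono strict_mono_imp_inj_on by blast
  have \<tau>\<theta>: "\<tau> (\<theta> t) = t" for t
    unfolding \<theta>_def using ex f_inv_into_f[of t \<tau> UNIV] by (metis UNIV_I rangeI)
  have \<theta>\<tau>: "\<theta> (\<tau> s) = s" for s unfolding \<theta>_def using inj by simp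
  have "(\<theta> has_real_derivative inverse (\<rho> (\<theta> t))) (at t)" for t
  proof (rule has_field_derivative_inverse_strong_x[of \<tau> "\<rho> (\<theta> t)" \<theta> t UNIV])
    show "continuous_on UNIV \<tau>" using cont by (simp add: continuous_on_eq_continuous_at)
    show "\<rho> (\<theta> t) \<noteq> 0" using pos[of "\<theta> t"] by simp
  qed (auto simp: der \<tau>\<theta> \<theta>\<tau>)
  then show ?thesis using that[OF T shift \<tau>\<theta> \<theta>\<tau> mono] by (simp add: inverse_eq_divide)
qed

lemma least_period_time_shift:
  assumes "least_period z T"
  shows "least_period (\<lambda>t. z (t + a)) T"
proof -
  have "(\<forall>t. z (t + s + a) = z (t + a)) \<longleftrightarrow> (\<forall>t. z (t + s) = z t)" for s
    by (metis add.assoc add.commute diff_add_cancel)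
  then show ?thesis using assms by (simp add: least_period_def)
qed

lemma least_period_unique: "least_period z S \<Longrightarrow> least_period z T \<Longrightarrow> S = T"
  unfolding least_period_def by (meson antisym)

lemma least_period_imp_nonconstant:
  assumes "least_period z T"
  shows "\<exists>t. z t \<noteq> c"
proof (rule ccontr)
  assume "\<not> ?thesis"
  then have "\<forall>t. z (t + T / 2) = z t" by simp
  moreover have "T / 2 > 0" using assms by (simp add: least_period_def)
  ultimately have "T \<le> T / 2" using assms unfolding least_period_def by blast
  then show False using assms by (simp add: least_period_def)
qed


section \<open>The flow in energy coordinates\<close>

text \<open>
  The angle is measured from the second axis towards the first, the direction in which \<open>(\<xi>, v)\<close>
  rotates under \<open>\<xi>' = v / w(\<xi>)\<close>, \<open>v' = -\<xi> / w(\<xi>)\<close>.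
\<close>

lemma polar_sin_cos:
  fixes a b :: real
  obtains \<theta> where "a = norm (a, b) * sin \<theta>" "b = norm (a, b) * cos \<theta>"
proof (cases "norm (a, b) = 0")
  case True
  then show ?thesis using that by (auto simp: prod_eq_iff)
next
  case False
  have "(b / norm (a, b))\<^sup>2 + (a / norm (a, b))\<^sup>2 = (a\<^sup>2 + b\<^sup>2) / (norm (a, b))\<^sup>2"
    by (simp add: power_divide add_divide_distrib)
  also have "\<dots> = 1" using False by (simp add: norm_Pair)
  finally obtain \<theta> where "b / norm (a, b) = cos \<theta>" "a / norm (a, b) = sin \<theta>"
    by (rule sincos_total_2pi)
  then show ?thesis using that False by (metis nonzero_eq_divide_eq mult.commute)
qed

lemma norm_circle_point: "c \<ge> 0 \<Longrightarrow> norm (c * sin \<theta>, c * cos \<theta>) = c"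
proof -
  assume "c \<ge> 0"
  have "(c * sin \<theta>)\<^sup>2 + (c * cos \<theta>)\<^sup>2 = c\<^sup>2 * ((sin \<theta>)\<^sup>2 + (cos \<theta>)\<^sup>2)"
    by (simp only: power_mult_distrib distrib_left)
  then show ?thesis using \<open>c \<ge> 0\<close> by (simp add: norm_Pair)
qed

text \<open>
  \<open>F\<close> is a primitive of \<open>f\<close>, \<open>Xi\<close> is the root \<open>\<xi>\<close> of twice the potential energy as a function of \<open>x\<close>,
  and \<open>X\<close> is its inverse. The assumption \<open>restoring\<close> is the derivative of \<open>\<xi>\<^sup>2 / 2 = \<integral> g exp (2 F)\<close> with
  respect to \<open>\<xi>\<close>.
\<close>

locale energy_coordinates =
  fixes f g F X Xi w :: "real \<Rightarrow> real" and I :: "real set" and R :: real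
  assumes R_pos: "R > 0"
    and X_0: "X 0 = 0"
    and X_in: "\<bar>\<xi>\<bar> < R \<Longrightarrow> X \<xi> \<in> I"
    and F_deriv: "\<bar>\<xi>\<bar> < R \<Longrightarrow> (F has_real_derivative f (X \<xi>)) (at (X \<xi>))"
    and X_deriv: "\<bar>\<xi>\<bar> < R \<Longrightarrow> (X has_real_derivative w \<xi> * exp (- F (X \<xi>))) (at \<xi>)"
    and Xi_X: "\<bar>\<xi>\<bar> < R \<Longrightarrow> Xi (X \<xi>) = \<xi>"
    and Xi_deriv: "\<bar>\<xi>\<bar> < R \<Longrightarrow> (Xi has_real_derivative exp (F (X \<xi>)) / w \<xi>) (at (X \<xi>))"
    and w_pos: "\<bar>\<xi>\<bar> < R \<Longrightarrow> w \<xi> > 0"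
    and w_cont: "\<bar>\<xi>\<bar> < R \<Longrightarrow> isCont w \<xi>"
    and restoring: "\<bar>\<xi>\<bar> < R \<Longrightarrow> g (X \<xi>) * exp (F (X \<xi>)) * w \<xi> = \<xi>"
begin

text \<open>
  From energy coordinates \<open>(\<xi>, v)\<close>, in which orbits are circles, to the phase plane \<open>(x, y)\<close>.
\<close>

definition Psi :: "real \<times> real \<Rightarrow> real \<times> real" where
  "Psi = (\<lambda>(\<xi>, v). (X \<xi>, v * exp (- F (X \<xi>))))"

lemma ball_imp_abs_less: "(\<xi>, v :: real) \<in> ball 0 R \<Longrightarrow> \<bar>\<xi>\<bar> < R"
  using norm_fst_le[of \<xi> v] by simp

lemma Psi_0: "Psi 0 = 0"
  by (simp add: Psi_def zero_prod_def X_0)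

lemma origin_eq_Psi_0: "(0, 0) = Psi 0"
  using Psi_0 unfolding zero_prod_def by simp

lemma inj_on_Psi: "inj_on Psi (ball 0 R)"
proof (rule inj_onI, clarify)
  fix a b a' b' assume *: "(a, b) \<in> ball 0 R" "(a', b') \<in> ball 0 R" "Psi (a, b) = Psi (a', b')"
  then have "X a = X a'" by (simp add: Psi_def)
  then have "a = a'" using Xi_X ball_imp_abs_less *(1,2) by metis
  then show "a = a' \<and> b = b'" using *(3) by (simp add: Psi_def)
qed

lemma continuous_on_Psi: "continuous_on (ball 0 R) Psi"
proof -
  have X: "continuous_on {-R<..<R} X"
    by (intro continuous_at_imp_continuous_on ballI X_deriv[THEN DERIV_isCont]) (simp add: abs_less_iff)
  have F: "continuous_on (X ` {-R<..<R}) F"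
    by (intro continuous_at_imp_continuous_on) (auto intro!: F_deriv[THEN DERIV_isCont] simp: abs_less_iff)
  have sub: "fst ` ball (0 :: real \<times> real) R \<subseteq> {-R<..<R}"
  proof (rule image_subsetI)
    fix p :: "real \<times> real" assume "p \<in> ball 0 R"
    then have "\<bar>fst p\<bar> < R" using ball_imp_abs_less[of "fst p" "snd p"] by simp
    then show "fst p \<in> {-R<..<R}" by (simp add: abs_less_iff)
  qed
  have Xc: "continuous_on (ball (0 :: real \<times> real) R) (\<lambda>p. X (fst p))"
    by (rule continuous_on_compose2[OF X _ sub]) (intro continuous_intros)
  have "continuous_on (ball (0 :: real \<times> real) R) (\<lambda>p. F (X (fst p)))"
    by (rule continuous_on_compose2[OF F Xc]) (use sub in blast)
  then have "continuous_on (ball (0 :: real \<times> real) R) (\<lambda>p. (X (fst p), snd p * exp (- F (X (fst p)))))"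
    using Xc by (intro continuous_intros)
  then show ?thesis by (simp add: Psi_def split_beta)
qed

text \<open>
  An injective continuous map between spaces of the same dimension is open.
\<close>

lemma open_Psi_ball: "c \<le> R \<Longrightarrow> open (Psi ` ball 0 c)"
  using continuous_on_Psi inj_on_Psi
  by (intro invariance_of_domain)
    (auto intro: continuous_on_subset inj_on_subset simp: subset_ball)

lemma Psi_ball_subset: "Psi ` ball 0 R \<subseteq> I \<times> UNIV"
proof (rule image_subsetI)
  fix p :: "real \<times> real" assume "p \<in> ball 0 R"
  then have "X (fst p) \<in> I" using ball_imp_abs_less[of "fst p" "snd p"] by (intro X_in) simp
  then show "Psi p \<in> I \<times> UNIV" by (simp add: Psi_def split_beta)
qed

text \<open>
  The complement of the level curve is covered by the open disc image and by the complement of the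
  compact closed disc image, which are disjoint and open. So the component of the origin stays in the
  disc image and is bounded.
\<close>

lemma origin_inside_level_curve:
  assumes "0 < c" "c < R"
  shows "(0, 0) \<in> inside (Psi ` sphere 0 c)"
proof -
  let ?S = "Psi ` sphere 0 c" and ?W = "Psi ` ball 0 c" and ?K = "Psi ` cball 0 c"
  have sub: "cball (0::real\<times>real) c \<subseteq> ball 0 R" using assms by auto
  have K: "compact ?K"
    using continuous_on_subset[OF continuous_on_Psi sub] by (rule compact_continuous_image) simp
  have W: "open ?W" using assms by (intro open_Psi_ball) simp
  note 0 = origin_eq_Psi_0
  have inW: "(0, 0) \<in> ?W" using assms by (simp add: 0)
  have notS: "(0, 0) \<notin> ?S"
  proof
    assume "(0, 0) \<in> ?S"
    then obtain p where "p \<in> sphere 0 c" "Psi p = Psi 0" using 0 by force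
    moreover from this have "p = 0"
      using inj_onD[OF inj_on_Psi, of p 0] assms by auto
    ultimately show False using assms by simp
  qed
  define C where "C = connected_component_set (- ?S) (0, 0)"
  have "?W \<inter> C = {} \<or> - ?K \<inter> C = {}"
  proof (rule connectedD)
    show "connected C" by (simp add: C_def)
    show "open (- ?K)" using K compact_imp_closed by blast
    show "?W \<inter> - ?K \<inter> C = {}" by force
    have "C \<subseteq> - ?S" unfolding C_def by (rule connected_component_subset)
    moreover have "cball (0::real \<times> real) c = ball 0 c \<union> sphere 0 c" by auto
    then have "?K = ?W \<union> ?S" by (simp flip: image_Un)
    ultimately show "C \<subseteq> ?W \<union> - ?K" by blast
  qed (rule W)
  moreover have "(0, 0) \<in> C" using notS by (simp add: C_def)
  ultimately have "C \<subseteq> ?K" using inW by blast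
  then have "bounded C" using K compact_imp_bounded bounded_subset by blast
  then show ?thesis using notS by (simp add: inside_def C_def)
qed

text \<open>
  In energy coordinates the angle has velocity \<open>1 / w(c sin \<theta>)\<close>, so \<open>\<tau>\<close> measures the time needed to
  reach a given angle on the circle of radius \<open>c\<close>, and \<open>\<tau>(2 \<pi>) - \<tau>(0)\<close> is the period.
\<close>

definition angular_clock :: "real \<Rightarrow> (real \<Rightarrow> real) \<Rightarrow> bool" where
  "angular_clock c \<tau> \<longleftrightarrow> (\<forall>s. (\<tau> has_real_derivative w (c * sin s)) (at s))"

lemma abs_circle_less:
  assumes "0 < c" "c < R"
  shows "\<bar>c * sin s\<bar> < R"
proof -
  have "\<bar>c * sin s\<bar> \<le> c * 1"
    using assms abs_sin_le_one[of s] unfolding abs_mult by (intro mult_mono) auto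
  then show ?thesis using assms by simp
qed

lemma angular_clock_exists:
  assumes "0 < c" "c < R"
  obtains \<tau> where "angular_clock c \<tau>"
proof -
  have "isCont (\<lambda>s. w (c * sin s)) s" for s
    by (rule isCont_o2[of _ "\<lambda>s. c * sin s"]) (auto intro!: continuous_intros w_cont abs_circle_less assms)
  then have "continuous_on UNIV (\<lambda>s. w (c * sin s))"
    by (simp add: continuous_on_eq_continuous_at)
  then show ?thesis using antiderivative_on_real_line that unfolding angular_clock_def by metis
qed

text \<open>
  The angular motion given by the inverse clock, carried to the phase plane. The period is least
  because injectivity of \<^const>\<open>Psi\<close> makes a return to the starting point a full number of revolutions.
\<close>

lemma level_curve_orbit:
  assumes c: "0 < c" "c < R" and \<tau>: "angular_clock c \<tau>"
  obtains z where "\<And>s. z (\<tau> s) = Psi (c * sin s, c * cos s)"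
    "complete_solution (lienard_field f g) (I \<times> UNIV) z"
    "least_period z (\<tau> (2 * pi) - \<tau> 0)" "range z = Psi ` sphere 0 c"
proof -
  let ?\<rho> = "\<lambda>s. w (c * sin s)" and ?T = "\<tau> (2 * pi) - \<tau> 0"
  note less = abs_circle_less[OF c]
  have d\<tau>: "(\<tau> has_real_derivative ?\<rho> s) (at s)" for s using \<tau> by (simp add: angular_clock_def)
  have \<rho>pos: "?\<rho> s > 0" for s by (intro w_pos less)
  have per: "?\<rho> (s + 2 * pi) = ?\<rho> s" for s by simp
  obtain \<theta> where T: "?T > 0" and shift: "\<And>s. \<tau> (s + 2 * pi) = \<tau> s + ?T"
    and \<tau>\<theta>: "\<And>t. \<tau> (\<theta> t) = t" and \<theta>\<tau>: "\<And>s. \<theta> (\<tau> s) = s" and mono: "strict_mono \<tau>"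
    and d\<theta>: "\<And>t. (\<theta> has_real_derivative 1 / ?\<rho> (\<theta> t)) (at t)"
    using periodic_clock_inverse[of \<tau> ?\<rho>, OF d\<tau> \<rho>pos per] by metis
  define z where "z t = Psi (c * sin (\<theta> t), c * cos (\<theta> t))" for t
  have in_ball: "(c * sin s, c * cos s) \<in> ball 0 R" for s
    using norm_circle_point[of c s] c by simp
  have sol: "complete_solution (lienard_field f g) (I \<times> UNIV) z"
    unfolding complete_solution_def
  proof (intro allI conjI)
    fix t
    show "z t \<in> I \<times> UNIV" using Psi_ball_subset in_ball unfolding z_def by blast
    define \<xi> v where "\<xi> = c * sin (\<theta> t)" and "v = c * cos (\<theta> t)"
    have a: "\<bar>\<xi>\<bar> < R" unfolding \<xi>_def by (rule less)
    have wp: "w \<xi> > 0" by (rule w_pos[OF a])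
    have d\<xi>: "((\<lambda>t. c * sin (\<theta> t)) has_real_derivative v / w \<xi>) (at t)"
      by (rule derivative_eq_intros d\<theta> refl)+ (simp add: \<xi>_def v_def)
    have dv: "((\<lambda>t. c * cos (\<theta> t)) has_real_derivative - \<xi> / w \<xi>) (at t)"
      by (rule derivative_eq_intros d\<theta> refl)+ (simp add: \<xi>_def v_def)
    have dX: "((\<lambda>t. X (c * sin (\<theta> t))) has_real_derivative v * exp (- F (X \<xi>))) (at t)"
      using DERIV_chain2[OF X_deriv[OF a, unfolded \<xi>_def] d\<xi>[unfolded \<xi>_def]] wp
      by (simp add: \<xi>_def mult.commute)
    have dF: "((\<lambda>t. F (X (c * sin (\<theta> t)))) has_real_derivative f (X \<xi>) * (v * exp (- F (X \<xi>)))) (at t)"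
      using DERIV_chain2[OF F_deriv[OF a, unfolded \<xi>_def] dX[unfolded \<xi>_def]] by (simp add: \<xi>_def)
    have "((\<lambda>t. c * cos (\<theta> t) * exp (- F (X (c * sin (\<theta> t))))) has_real_derivative
        - \<xi> / w \<xi> * exp (- F (X \<xi>)) - f (X \<xi>) * (v * exp (- F (X \<xi>)))\<^sup>2) (at t)"
      by (rule derivative_eq_intros dv dF refl)+
        (simp add: \<xi>_def v_def power2_eq_square algebra_simps)
    moreover have "g (X \<xi>) = \<xi> / w \<xi> * exp (- F (X \<xi>))"
      using restoring[OF a] wp by (simp add: exp_minus field_simps)
    ultimately have dY: "((\<lambda>t. c * cos (\<theta> t) * exp (- F (X (c * sin (\<theta> t))))) has_real_derivative
        - g (X \<xi>) - f (X \<xi>) * (v * exp (- F (X \<xi>)))\<^sup>2) (at t)"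
      by simp
    have "z = (\<lambda>t. (X (c * sin (\<theta> t)), c * cos (\<theta> t) * exp (- F (X (c * sin (\<theta> t))))))"
      by (simp add: z_def Psi_def fun_eq_iff)
    then show "(z has_vector_derivative lienard_field f g (z t)) (at t)"
      using dX dY unfolding has_real_derivative_iff_has_vector_derivative
      by (auto simp: lienard_field_def \<xi>_def v_def intro!: has_vector_derivative_Pair)
  qed
  have z\<tau>: "z (\<tau> s) = Psi (c * sin s, c * cos s)" for s by (simp add: z_def \<theta>\<tau>)
  have per: "z (t + ?T) = z t" for t
    using z\<tau>[of "\<theta> t + 2 * pi"] by (simp add: shift \<tau>\<theta> z_def)
  have least: "?T \<le> s" if s: "s > 0" "\<forall>t. z (t + s) = z t" for s
  proof -
    define \<sigma> where "\<sigma> = \<theta> (\<tau> 0 + s)"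
    have "\<tau> 0 < \<tau> \<sigma>" using s(1) by (simp add: \<sigma>_def \<tau>\<theta>)
    then have "0 < \<sigma>" using strict_mono_less[OF mono] by blast
    have "z (\<tau> \<sigma>) = z (\<tau> 0)" using s(2) by (simp add: \<sigma>_def \<tau>\<theta>)
    then have "(c * sin \<sigma>, c * cos \<sigma>) = (c * sin 0, c * cos 0)"
      unfolding z\<tau> by (rule inj_onD[OF inj_on_Psi _ in_ball in_ball])
    then have "cos \<sigma> = 1" using c by simp
    then have "2 * pi \<le> \<sigma>"
    proof -
      obtain k :: int where k: "\<sigma> = of_int k * (2 * pi)"
        using \<open>cos \<sigma> = 1\<close> cos_one_2pi_int[of \<sigma>] by (auto simp: mult.assoc)
      then have "0 < k" using \<open>0 < \<sigma>\<close> by (simp add: zero_less_mult_iff)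
      then have "1 * (2 * pi) \<le> of_int k * (2 * pi)" by (intro mult_right_mono) auto
      then show ?thesis using k by simp
    qed
    then have "\<tau> (2 * pi) \<le> \<tau> \<sigma>" using strict_mono_less_eq[OF mono] by blast
    then show ?thesis by (simp add: \<sigma>_def \<tau>\<theta>)
  qed
  have "range z = Psi ` sphere 0 c"
  proof
    show "range z \<subseteq> Psi ` sphere 0 c"
      unfolding z_def using norm_circle_point[of c] c by auto
    show "Psi ` sphere 0 c \<subseteq> range z"
    proof (rule image_subsetI)
      fix p :: "real \<times> real" assume "p \<in> sphere 0 c"
      then have n: "norm (fst p, snd p) = c" by simp
      obtain s where "fst p = c * sin s" "snd p = c * cos s"
        using polar_sin_cos[of "fst p" "snd p"] unfolding n by blast
      then have "p = (c * sin s, c * cos s)" by (simp add: prod_eq_iff)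
      then show "Psi p \<in> range z" by (simp flip: z\<tau>)
    qed
  qed
  then show ?thesis using that[OF z\<tau> sol] T per least by (simp add: least_period_def)
qed

text \<open>
  Uniqueness of solutions in explicit form. Pulled back to energy coordinates, \<open>(\<xi>, v)\<close> rotates with
  the angular velocity \<open>1 / w(\<xi>)\<close>. Rotating it back by the accumulated angle \<open>\<Theta>\<close> gives a constant
  vector, so \<open>(\<xi>, v)\<close> moves on a circle, and along it \<open>\<tau>\<close> grows at unit rate. The solution is
  therefore a time shift of the one built in \<open>level_curve_orbit\<close>.
\<close>

lemma periodic_orbit_in_disc:
  assumes "periodic_orbit (lienard_field f g) (I \<times> UNIV) S \<gamma>" "\<gamma> \<subseteq> Psi ` ball 0 R"
  obtains c where "0 < c" "c < R" "\<And>\<tau>. angular_clock c \<tau> \<Longrightarrow> S = \<tau> (2 * pi) - \<tau> 0"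
proof -
  obtain z where z: "complete_solution (lienard_field f g) (I \<times> UNIV) z" "least_period z S"
      "\<gamma> = range z"
    using assms(1) by (auto simp: periodic_orbit_def)
  have "\<exists>p. p \<in> ball 0 R \<and> z t = Psi p" for t using z(3) assms(2) by blast
  then obtain p where p: "\<And>t. p t \<in> ball 0 R" "\<And>t. z t = Psi (p t)" by metis
  define \<xi> v where "\<xi> t = fst (p t)" and "v t = snd (p t)" for t
  have pt: "p t = (\<xi> t, v t)" for t by (simp add: \<xi>_def v_def)
  have a: "\<bar>\<xi> t\<bar> < R" for t using p(1)[of t] unfolding pt by (rule ball_imp_abs_less)
  have wp: "w (\<xi> t) > 0" for t by (rule w_pos[OF a])
  define x y where "x t = fst (z t)" and "y t = snd (z t)" for t
  have x: "x t = X (\<xi> t)" and y: "y t = v t * exp (- F (X (\<xi> t)))" for t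
    by (simp_all add: x_def y_def p(2) pt Psi_def)
  have dz: "(z has_vector_derivative (y t, - g (x t) - f (x t) * (y t)\<^sup>2)) (at t)" for t
    using z(1) by (simp add: complete_solution_def lienard_field_def x_def y_def split_beta)
  have dx: "(x has_real_derivative y t) (at t)" for t
    using bounded_linear.has_vector_derivative[OF bounded_linear_fst dz]
    by (simp add: x_def[abs_def] has_real_derivative_iff_has_vector_derivative)
  have dy: "(y has_real_derivative - g (x t) - f (x t) * (y t)\<^sup>2) (at t)" for t
    using bounded_linear.has_vector_derivative[OF bounded_linear_snd dz]
    by (simp add: y_def[abs_def] has_real_derivative_iff_has_vector_derivative)
  have \<xi>x: "\<xi> = (\<lambda>t. Xi (x t))" using Xi_X[OF a] by (simp add: x fun_eq_iff)
  have vy: "v = (\<lambda>t. y t * exp (F (x t)))" by (simp add: x y fun_eq_iff flip: exp_add)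
  have d\<xi>: "(\<xi> has_real_derivative v t / w (\<xi> t)) (at t)" for t
  proof -
    have "((\<lambda>t. Xi (x t)) has_real_derivative exp (F (X (\<xi> t))) / w (\<xi> t) * y t) (at t)"
      using DERIV_chain2[OF Xi_deriv[OF a[of t], folded x] dx] by (simp add: x)
    then show ?thesis unfolding \<xi>x[symmetric] by (simp add: y exp_minus field_simps)
  qed
  have dv: "(v has_real_derivative - \<xi> t / w (\<xi> t)) (at t)" for t
  proof -
    have dF: "((\<lambda>t. F (x t)) has_real_derivative f (x t) * y t) (at t)"
      using DERIV_chain2[OF F_deriv[OF a[of t], folded x] dx] by simp
    have "((\<lambda>t. y t * exp (F (x t))) has_real_derivative - g (x t) * exp (F (x t))) (at t)"
      by (rule derivative_eq_intros dy dF refl)+ (simp add: power2_eq_square algebra_simps)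
    moreover have "g (x t) * exp (F (x t)) = \<xi> t / w (\<xi> t)"
      using restoring[OF a[of t]] wp[of t] by (simp add: x field_simps)
    ultimately show ?thesis unfolding vy[symmetric] by simp
  qed
  have "isCont (\<lambda>t. 1 / w (\<xi> t)) t" for t
  proof -
    have "isCont (\<lambda>t. w (\<xi> t)) t"
      by (rule isCont_o2[OF DERIV_isCont[OF d\<xi>] w_cont[OF a]])
    then show ?thesis using wp[of t] by (intro continuous_intros) auto
  qed
  then have "continuous_on UNIV (\<lambda>t. 1 / w (\<xi> t))" by (simp add: continuous_on_eq_continuous_at)
  then obtain \<Theta> where d\<Theta>: "\<And>t. (\<Theta> has_real_derivative 1 / w (\<xi> t)) (at t)"
    using antiderivative_on_real_line by metis
  \<comment> \<open>the coordinates rotated back by the accumulated angle\<close>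
  define P Q where "P t = \<xi> t * cos (\<Theta> t) - v t * sin (\<Theta> t)"
    and "Q t = \<xi> t * sin (\<Theta> t) + v t * cos (\<Theta> t)" for t
  have "(P has_real_derivative 0) (at t)" for t
    unfolding P_def by (rule derivative_eq_intros d\<xi> dv d\<Theta> refl)+ (simp add: algebra_simps)
  then have P: "P t = P 0" for t using DERIV_isconst_all by blast
  have "(Q has_real_derivative 0) (at t)" for t
    unfolding Q_def by (rule derivative_eq_intros d\<xi> dv d\<Theta> refl)+ (simp add: algebra_simps)
  then have Q: "Q t = Q 0" for t using DERIV_isconst_all by blast
  define c where "c = norm (P 0, Q 0)"
  obtain \<theta>0 where \<theta>0: "P 0 = c * sin \<theta>0" "Q 0 = c * cos \<theta>0"
    unfolding c_def by (rule polar_sin_cos)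
  have \<xi>: "\<xi> t = c * sin (\<theta>0 + \<Theta> t)" for t
  proof -
    have "c * sin (\<theta>0 + \<Theta> t) = P t * cos (\<Theta> t) + Q t * sin (\<Theta> t)"
      unfolding P[of t] Q[of t] \<theta>0 by (simp add: sin_add algebra_simps)
    also have "\<dots> = \<xi> t * ((sin (\<Theta> t))\<^sup>2 + (cos (\<Theta> t))\<^sup>2)"
      unfolding P_def Q_def by (simp only: power2_eq_square algebra_simps)
    finally show ?thesis by simp
  qed
  have v: "v t = c * cos (\<theta>0 + \<Theta> t)" for t
  proof -
    have "c * cos (\<theta>0 + \<Theta> t) = Q t * cos (\<Theta> t) - P t * sin (\<Theta> t)"
      unfolding P[of t] Q[of t] \<theta>0 by (simp add: cos_add algebra_simps)
    also have "\<dots> = v t * ((sin (\<Theta> t))\<^sup>2 + (cos (\<Theta> t))\<^sup>2)"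
      unfolding P_def Q_def by (simp only: power2_eq_square algebra_simps)
    finally show ?thesis by simp
  qed
  have c0: "c \<ge> 0" by (simp add: c_def)
  have "norm (p 0) = c" unfolding pt \<xi> v using c0 by (rule norm_circle_point)
  then have cR: "c < R" using p(1)[of 0] by simp
  have "c \<noteq> 0"
  proof
    assume "c = 0"
    then have "z t = Psi (0, 0)" for t unfolding p(2) pt \<xi> v by simp
    then show False using least_period_imp_nonconstant[OF z(2)] by blast
  qed
  then have cpos: "c > 0" using c0 by simp
  have "S = \<tau> (2 * pi) - \<tau> 0" if \<tau>: "angular_clock c \<tau>" for \<tau>
  proof -
    obtain Z where Z: "\<And>s. Z (\<tau> s) = Psi (c * sin s, c * cos s)"
      "least_period Z (\<tau> (2 * pi) - \<tau> 0)"
      using level_curve_orbit[OF cpos cR \<tau>] by metis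
    have "((\<lambda>t. \<tau> (\<theta>0 + \<Theta> t) - t) has_real_derivative 0) (at t)" for t
    proof -
      have "((\<lambda>t. \<theta>0 + \<Theta> t) has_real_derivative 1 / w (\<xi> t)) (at t)"
        by (rule derivative_eq_intros d\<Theta> refl)+ simp
      moreover have "(\<tau> has_real_derivative w (\<xi> t)) (at (\<theta>0 + \<Theta> t))"
        using \<tau> \<xi> by (simp add: angular_clock_def)
      ultimately have "((\<lambda>t. \<tau> (\<theta>0 + \<Theta> t)) has_real_derivative w (\<xi> t) * (1 / w (\<xi> t))) (at t)"
        by (rule DERIV_chain2[rotated])
      then show ?thesis using wp[of t] by (auto intro!: derivative_eq_intros)
    qed
    then have const: "\<tau> (\<theta>0 + \<Theta> t) - t = \<tau> (\<theta>0 + \<Theta> 0) - 0" for t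
      using DERIV_isconst_all[of "\<lambda>t. \<tau> (\<theta>0 + \<Theta> t) - t" t 0] by blast
    have clock: "\<tau> (\<theta>0 + \<Theta> t) = t + \<tau> (\<theta>0 + \<Theta> 0)" for t
      using const[of t] by linarith
    have "z = (\<lambda>t. Z (t + \<tau> (\<theta>0 + \<Theta> 0)))"
      using Z(1) by (simp add: fun_eq_iff p(2) pt \<xi> v flip: clock)
    then show ?thesis using least_period_time_shift[OF Z(2)] z(2) least_period_unique by blast
  qed
  then show ?thesis using that cpos cR by blast
qed

lemma origin_is_center: "is_center (lienard_field f g) (I \<times> UNIV) (0, 0)"
  unfolding is_center_def
proof (rule exI[of _ "Psi ` ball 0 R"], intro conjI ballI)
  note 0 = origin_eq_Psi_0
  show "open (Psi ` ball 0 R)" by (simp add: open_Psi_ball)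
  show "(0, 0) \<in> Psi ` ball 0 R" using R_pos by (simp add: 0)
  show "Psi ` ball 0 R \<subseteq> I \<times> UNIV" by (rule Psi_ball_subset)
  fix q assume q: "q \<in> Psi ` ball 0 R - {(0, 0)}"
  then obtain p where p: "p \<in> ball 0 R" "q = Psi p" by blast
  define c where "c = norm p"
  have "p \<noteq> 0" using q p(2) 0 by auto
  then have c: "0 < c" "c < R" using p(1) by (auto simp: c_def)
  obtain \<tau> where \<tau>: "angular_clock c \<tau>" using angular_clock_exists[OF c] .
  obtain z where z: "complete_solution (lienard_field f g) (I \<times> UNIV) z"
    "least_period z (\<tau> (2 * pi) - \<tau> 0)" "range z = Psi ` sphere 0 c"
    using level_curve_orbit[OF c \<tau>] by metis
  have "periodic_orbit (lienard_field f g) (I \<times> UNIV) (\<tau> (2 * pi) - \<tau> 0) (Psi ` sphere 0 c)"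
    unfolding periodic_orbit_def using z by metis
  moreover have "q \<in> Psi ` sphere 0 c" using p(2) by (simp add: c_def)
  moreover have "Psi ` sphere 0 c \<subseteq> Psi ` ball 0 R - {(0, 0)}"
  proof -
    have "Psi r \<noteq> Psi 0" if "r \<in> sphere 0 c" for r
      using that c R_pos inj_onD[OF inj_on_Psi, of r 0] by auto
    then show ?thesis using c unfolding 0 by force
  qed
  moreover have "(0, 0) \<in> inside (Psi ` sphere 0 c)" using origin_inside_level_curve[OF c] .
  ultimately show "\<exists>T \<gamma>. periodic_orbit (lienard_field f g) (I \<times> UNIV) T \<gamma> \<and> q \<in> \<gamma> \<and>
      \<gamma> \<subseteq> Psi ` ball 0 R - {(0, 0)} \<and> (0, 0) \<in> inside \<gamma>"
    by blast
qed

text \<open>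
  Averaging \<open>\<tau>(s)\<close> with its reflection \<open>- \<tau>(2 \<pi> - s)\<close> does not change the increment over
  \<open>[0, 2 \<pi>]\<close>, and it replaces \<open>w\<close> by its even part, as \<open>sin\<close> is odd about \<open>\<pi>\<close>. The period minus
  \<open>2 \<pi>\<close> is thus the integral of the even part minus \<open>1\<close>.
\<close>

lemma period_defect_antiderivative:
  assumes "angular_clock c \<tau>"
  obtains K where "\<And>s. (K has_real_derivative (w (c * sin s) + w (- (c * sin s))) / 2 - 1) (at s)"
    "K (2 * pi) - K 0 = \<tau> (2 * pi) - \<tau> 0 - 2 * pi"
proof -
  have d: "(\<tau> has_real_derivative w (c * sin s)) (at s)" for s
    using assms by (simp add: angular_clock_def)
  have refl': "((\<lambda>s. \<tau> (2 * pi - s)) has_real_derivative w (- (c * sin s)) * (- 1)) (at s)" for s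
  proof (rule DERIV_chain2[where f = \<tau> and g = "\<lambda>s. 2 * pi - s"])
    show "(\<tau> has_real_derivative w (- (c * sin s))) (at (2 * pi - s))"
      using d[of "2 * pi - s"] by (simp add: sin_diff)
    show "((\<lambda>s. 2 * pi - s) has_real_derivative - 1) (at s)"
      by (auto intro!: derivative_eq_intros)
  qed
  show ?thesis
  proof (rule that)
    show "((\<lambda>s. (\<tau> s - \<tau> (2 * pi - s)) / 2 - s) has_real_derivative
        (w (c * sin s) + w (- (c * sin s))) / 2 - 1) (at s)" for s
      using DERIV_diff[OF DERIV_cdivide[OF DERIV_diff[OF d[of s] refl'[of s]], of 2] DERIV_ident] by simp
  qed (simp add: field_simps)
qed

lemma isochronous_if_even_part_constant:
  assumes "\<And>\<xi>. \<bar>\<xi>\<bar> < R \<Longrightarrow> w \<xi> + w (- \<xi>) = 2"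
  shows "isochronous_center (lienard_field f g) (I \<times> UNIV) (0, 0)"
  unfolding isochronous_center_def
proof (intro conjI exI allI impI)
  show "is_center (lienard_field f g) (I \<times> UNIV) (0, 0)" by (rule origin_is_center)
  show "open (Psi ` ball 0 R)" by (simp add: open_Psi_ball)
  show "(0, 0) \<in> Psi ` ball 0 R" using R_pos by (simp add: origin_eq_Psi_0)
  fix \<gamma> S assume "periodic_orbit (lienard_field f g) (I \<times> UNIV) S \<gamma> \<and> \<gamma> \<subseteq> Psi ` ball 0 R"
  then obtain c where c: "0 < c" "c < R" "\<And>\<tau>. angular_clock c \<tau> \<Longrightarrow> S = \<tau> (2 * pi) - \<tau> 0"
    using periodic_orbit_in_disc by metis
  obtain \<tau> where \<tau>: "angular_clock c \<tau>" using angular_clock_exists[OF c(1,2)] .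
  obtain K where K: "\<And>s. (K has_real_derivative (w (c * sin s) + w (- (c * sin s))) / 2 - 1) (at s)"
    "K (2 * pi) - K 0 = \<tau> (2 * pi) - \<tau> 0 - 2 * pi"
    using period_defect_antiderivative[OF \<tau>] by metis
  have "(K has_real_derivative 0) (at s)" for s
    using K(1)[of s] assms[OF abs_circle_less[OF c(1,2)], of s] by simp
  then have "K (2 * pi) = K 0" using DERIV_isconst_all by blast
  then show "S = 2 * pi" using K(2) c(3)[OF \<tau>] by simp
qed

text \<open>
  The neighborhood in which all periods agree contains the images of all sufficiently small discs.
\<close>

lemma small_periods_constant:
  assumes "isochronous_center (lienard_field f g) (I \<times> UNIV) (0, 0)"
  shows "\<exists>T r. 0 < r \<and> r \<le> R \<and>
    (\<forall>c \<tau>. 0 < c \<and> c < r \<and> angular_clock c \<tau> \<longrightarrow> \<tau> (2 * pi) - \<tau> 0 = T)"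
proof -
  obtain V T where V: "open V" "(0, 0) \<in> V"
    "\<forall>\<gamma> S. periodic_orbit (lienard_field f g) (I \<times> UNIV) S \<gamma> \<and> \<gamma> \<subseteq> V \<longrightarrow> S = T"
    using assms unfolding isochronous_center_def by blast
  have "open (Psi -` V \<inter> ball 0 R)"
    using continuous_on_Psi V(1) by (simp add: continuous_on_open_vimage)
  moreover have "0 \<in> Psi -` V \<inter> ball 0 R"
    using V(2) R_pos by (simp add: origin_eq_Psi_0)
  ultimately obtain r where r: "r > 0" "ball 0 r \<subseteq> Psi -` V \<inter> ball 0 R"
    using open_contains_ball by blast
  show ?thesis
  proof (rule exI[of _ T], rule exI[of _ "min r R"], intro conjI allI impI)
    show "0 < min r R" "min r R \<le> R" using r R_pos by auto
    fix c \<tau> assume "0 < c \<and> c < min r R \<and> angular_clock c \<tau>"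
    then have c: "0 < c" "c < min r R" and \<tau>: "angular_clock c \<tau>" by auto
    obtain z where z: "complete_solution (lienard_field f g) (I \<times> UNIV) z"
      "least_period z (\<tau> (2 * pi) - \<tau> 0)" "range z = Psi ` sphere 0 c"
      using level_curve_orbit[of c \<tau>] c \<tau> by (metis min_less_iff_conj)
    have "periodic_orbit (lienard_field f g) (I \<times> UNIV) (\<tau> (2 * pi) - \<tau> 0) (Psi ` sphere 0 c)"
      unfolding periodic_orbit_def using z by metis
    moreover have "Psi ` sphere 0 c \<subseteq> V"
    proof -
      have "sphere 0 c \<subseteq> ball (0::real\<times>real) r" using c by auto
      then show ?thesis using r(2) by blast
    qed
    ultimately show "\<tau> (2 * pi) - \<tau> 0 = T" using V(3) by blast
  qed
qed

text \<open>
  The sign \<open>\<sigma>\<close> treats both possible signs of the even part minus \<open>1\<close> at once: the antiderivative of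
  the period defect is strictly monotone on \<open>[0, \<pi>]\<close> and monotone on \<open>[\<pi>, 2 \<pi>]\<close>.
\<close>

lemma period_defect_nonzero:
  assumes c: "0 < c" "c < R" and \<tau>: "angular_clock c \<tau>" and \<sigma>: "\<sigma> = 1 \<or> \<sigma> = -1"
    and e: "\<And>\<xi>. 0 < \<xi> \<Longrightarrow> \<xi> \<le> c \<Longrightarrow> \<sigma> * (w \<xi> + w (- \<xi>) - 2) > 0" and w0: "w 0 = 1"
  shows "\<sigma> * (\<tau> (2 * pi) - \<tau> 0 - 2 * pi) > 0"
proof -
  obtain K where K: "\<And>s. (K has_real_derivative (w (c * sin s) + w (- (c * sin s))) / 2 - 1) (at s)"
    "K (2 * pi) - K 0 = \<tau> (2 * pi) - \<tau> 0 - 2 * pi"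
    using period_defect_antiderivative[OF \<tau>] by metis
  define E where "E \<xi> = \<sigma> * ((w \<xi> + w (- \<xi>)) / 2 - 1)" for \<xi>
  have E: "E \<xi> > 0" if "\<bar>\<xi>\<bar> \<le> c" "\<xi> \<noteq> 0" for \<xi>
  proof -
    have even: "E \<xi> = E \<bar>\<xi>\<bar>" by (simp add: E_def abs_if add.commute)
    have "\<sigma> * (w \<bar>\<xi>\<bar> + w (- \<bar>\<xi>\<bar>) - 2) > 0" using that by (intro e) auto
    then have "E \<bar>\<xi>\<bar> > 0" unfolding E_def by (simp add: algebra_simps)
    then show ?thesis using even by linarith
  qed
  have E0: "E 0 = 0" by (simp add: E_def w0)
  have le: "\<bar>c * sin s\<bar> \<le> c" for s
    using c abs_sin_le_one[of s] by (simp add: abs_mult)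
  have nn: "E (c * sin s) \<ge> 0" for s
    using E[OF le, of s] E0 by (cases "c * sin s = 0") auto
  have dK: "((\<lambda>s. \<sigma> * K s) has_real_derivative E (c * sin s)) (at s)" for s
    unfolding E_def by (rule derivative_eq_intros K(1) refl)+ simp
  have cont: "continuous_on A (\<lambda>s. \<sigma> * K s)" for A
    using dK by (intro continuous_at_imp_continuous_on ballI DERIV_isCont)
  have "\<sigma> * K 0 < \<sigma> * K pi"
  proof (rule DERIV_pos_imp_increasing_open[where f = "\<lambda>s. \<sigma> * K s"])
    show "\<exists>y. ((\<lambda>s. \<sigma> * K s) has_real_derivative y) (at s) \<and> 0 < y" if "0 < s" "s < pi" for s
      using dK[of s] E[OF le, of s] sin_gt_zero[OF that] c by force
  qed (auto intro: cont)
  also have "\<sigma> * K pi \<le> \<sigma> * K (2 * pi)"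
    by (rule DERIV_nonneg_imp_nondecreasing[where f = "\<lambda>s. \<sigma> * K s"]) (use dK nn in auto)
  finally have "\<sigma> * (K (2 * pi) - K 0) > 0" by (simp add: algebra_simps)
  then show ?thesis using K(2) by simp
qed

text \<open>
  Suppose that the even part of \<open>w\<close> minus \<open>1\<close> has \<open>0\<close> as an isolated zero. Continuity of \<open>w\<close> at \<open>0\<close>
  forces the common period of small orbits to be \<open>2 \<pi>\<close>. On a small interval \<open>(0, c]\<close> the even part
  minus \<open>1\<close> has no zero and hence a constant sign, so the orbit of radius \<open>c\<close> has another period.
\<close>

lemma even_part_constant_if_isochronous:
  assumes iso: "isochronous_center (lienard_field f g) (I \<times> UNIV) (0, 0)" and w0: "w 0 = 1"
    and isolated: "(\<forall>\<^sub>F \<xi> in nhds 0. w \<xi> + w (- \<xi>) - 2 = 0) \<or> (\<forall>\<^sub>F \<xi> in at 0. w \<xi> + w (- \<xi>) - 2 \<noteq> 0)"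
  shows "\<forall>\<^sub>F \<xi> in nhds 0. w \<xi> + w (- \<xi>) - 2 = 0"
proof (rule ccontr)
  assume "\<not> ?thesis"
  then have "\<forall>\<^sub>F \<xi> in at 0. w \<xi> + w (- \<xi>) - 2 \<noteq> 0" using isolated by blast
  then obtain d where d: "d > 0" "\<And>\<xi>. \<xi> \<noteq> 0 \<Longrightarrow> \<bar>\<xi>\<bar> < d \<Longrightarrow> w \<xi> + w (- \<xi>) - 2 \<noteq> 0"
    by (auto simp: eventually_at dist_real_def)
  obtain T r where r: "0 < r" "r \<le> R"
    and period: "\<forall>c \<tau>. 0 < c \<and> c < r \<and> angular_clock c \<tau> \<longrightarrow> \<tau> (2 * pi) - \<tau> 0 = T"
    using small_periods_constant[OF iso] by blast
  have T: "T = 2 * pi"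
  proof (rule ccontr)
    assume "T \<noteq> 2 * pi"
    \<comment> \<open>the mean value theorem turns the period into \<open>2 \<pi>\<close> times a value of \<open>w\<close> near \<open>0\<close>\<close>
    define \<epsilon> where "\<epsilon> = \<bar>T / (2 * pi) - 1\<bar>"
    have "\<epsilon> > 0" using \<open>T \<noteq> 2 * pi\<close> by (simp add: \<epsilon>_def field_simps)
    then obtain \<delta> where \<delta>: "\<delta> > 0" "\<And>\<xi>. \<bar>\<xi>\<bar> < \<delta> \<Longrightarrow> \<bar>w \<xi> - 1\<bar> < \<epsilon>"
      using w_cont[of 0] R_pos w0 unfolding continuous_at_eps_delta
      by (auto simp: dist_real_def)
    define c where "c = min r \<delta> / 2"
    have c: "0 < c" "c < r" "c < \<delta>" using r(1) \<delta>(1) by (auto simp: c_def)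
    obtain \<tau> where \<tau>: "angular_clock c \<tau>" using angular_clock_exists[of c] c r by auto
    have "\<exists>s>0. s < 2 * pi \<and> \<tau> (2 * pi) - \<tau> 0 = (2 * pi - 0) * w (c * sin s)"
      by (rule MVT2) (use \<tau> in \<open>auto simp: angular_clock_def\<close>)
    then obtain s where "\<tau> (2 * pi) - \<tau> 0 = 2 * pi * w (c * sin s)" by auto
    then have "T / (2 * pi) = w (c * sin s)" using period c(1,2) \<tau> by simp
    moreover have "\<bar>c * sin s\<bar> \<le> c * 1"
      unfolding abs_mult using c by (intro mult_mono) auto
    ultimately show False using \<delta>(2)[of "c * sin s"] c by (simp add: \<epsilon>_def)
  qed
  define c where "c = min r d / 2"
  have c: "0 < c" "c < r" "c < d" "c < R" using r d(1) by (auto simp: c_def)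
  obtain \<tau> where \<tau>: "angular_clock c \<tau>" using angular_clock_exists[of c] c by auto
  define e where "e \<xi> = w \<xi> + w (- \<xi>) - 2" for \<xi>
  have cont: "continuous_on {\<xi>..c} e" if "0 < \<xi>" for \<xi>
    unfolding e_def using that c
    by (intro continuous_at_imp_continuous_on ballI continuous_intros w_cont isCont_o2[of _ uminus w]) auto
  define \<sigma> where "\<sigma> = sgn (e c)"
  have ne: "e \<xi> \<noteq> 0" if "0 < \<xi>" "\<xi> \<le> c" for \<xi> using d(2)[of \<xi>] that c by (simp add: e_def)
  have "\<sigma> * e \<xi> > 0" if \<xi>: "0 < \<xi>" "\<xi> \<le> c" for \<xi>
  proof (rule ccontr)
    assume "\<not> ?thesis"
    then have neg: "e c * e \<xi> \<le> 0" using ne[of c] c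
      by (auto simp: \<sigma>_def sgn_if mult_le_0_iff split: if_splits)
    have "\<exists>x\<ge>\<xi>. x \<le> c \<and> e x = 0"
    proof (cases "e \<xi> \<le> 0")
      case True
      then have "0 \<le> e c" using neg ne[OF \<xi>] by (auto simp: mult_le_0_iff)
      then show ?thesis using IVT'[OF True _ \<xi>(2) cont[OF \<xi>(1)]] by blast
    next
      case False
      then have "e c \<le> 0" using neg by (auto simp: mult_le_0_iff)
      then show ?thesis using IVT2'[of e c 0 \<xi>] False \<xi>(2) cont[OF \<xi>(1)] by auto
    qed
    then show False using ne \<xi> by force
  qed
  then have "\<sigma> * (\<tau> (2 * pi) - \<tau> 0 - 2 * pi) > 0"
    using ne[of c] c by (intro period_defect_nonzero[OF c(1) c(4) \<tau> _ _ w0]) (auto simp: \<sigma>_def sgn_if e_def)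
  then show False using period c(1,2) \<tau> T by simp
qed

end

text \<open>
  Statements about germs hold only on smaller discs, so the radius must be adjustable.
\<close>

lemma energy_coordinates_shrink:
  assumes "energy_coordinates f g F X Xi w I R" "0 < r" "r \<le> R"
  shows "energy_coordinates f g F X Xi w I r"
  using assms unfolding energy_coordinates_def by simp


section \<open>Existence of energy coordinates\<close>

text \<open>
  For \<open>\<phi> = g exp (2 F)\<close> this is the potential energy: it vanishes to second order, with the leading
  coefficient \<open>1 / 2\<close> because \<open>\<phi>' 0 = 1\<close>.
\<close>

lemma primitive_square_factor:
  assumes \<phi>: "analytic_germ \<phi>" "\<phi> 0 = 0" "deriv \<phi> 0 = 1"
  obtains E A where "analytic_germ A" "A 0 = 1 / 2" "\<forall>x. E x = x\<^sup>2 * A x"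
    "\<forall>\<^sub>F x in nhds 0. (E has_real_derivative \<phi> x) (at x)"
proof -
  obtain E where E: "analytic_germ E" "E 0 = 0"
    "\<forall>\<^sub>F x in nhds 0. (E has_real_derivative \<phi> x) (at x)"
    using analytic_germ_primitive[OF \<phi>(1)] .
  obtain B where B: "analytic_germ B" "\<forall>x. E x = x * B x"
    using analytic_germ_divide_ident[OF E(1,2)] .
  \<comment> \<open>both sides of \<open>E x = x * B x\<close> are differentiated at \<open>0\<close>, to see that \<open>x\<close> can be split off again\<close>
  have "((\<lambda>x. x * B x) has_real_derivative B 0) (at 0)"
    by (rule derivative_eq_intros analytic_germ_derivative_at_0[OF B(1)] refl)+ simp
  moreover have "E = (\<lambda>x. x * B x)" using B(2) by auto
  ultimately have "B 0 = \<phi> 0"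
    using eventually_nhds_x_imp_x[OF E(3)] DERIV_unique by metis
  then have "B 0 = 0" using \<phi>(2) by simp
  then obtain A where A: "analytic_germ A" "\<forall>x. B x = x * A x"
    using analytic_germ_divide_ident[OF B(1)] by metis
  have EA: "E x = x\<^sup>2 * A x" for x using B(2) A(2) by (simp add: power2_eq_square)
  \<comment> \<open>the value of \<open>A\<close> at \<open>0\<close> comes from the second derivative of \<open>E\<close> there\<close>
  have ev: "\<forall>\<^sub>F x in nhds 0. 2 * x * A x + x\<^sup>2 * deriv A x = \<phi> x"
    using E(3) analytic_germ_differentiable[OF A(1)]
  proof eventually_elim
    case (elim x)
    have "((\<lambda>x. x\<^sup>2 * A x) has_real_derivative 2 * x * A x + x\<^sup>2 * deriv A x) (at x)"
      by (rule derivative_eq_intros elim(2) refl)+ simp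
    moreover have "E = (\<lambda>x. x\<^sup>2 * A x)" using EA by auto
    ultimately show ?case using elim(1) DERIV_unique by metis
  qed
  have "((\<lambda>x. 2 * x * A x + x\<^sup>2 * deriv A x) has_real_derivative 2 * A 0) (at 0)"
    by (rule derivative_eq_intros analytic_germ_derivative_at_0[OF A(1)]
        analytic_germ_derivative_at_0[OF analytic_germ_deriv[OF A(1)]] refl)+ simp
  then have "(\<phi> has_real_derivative 2 * A 0) (at 0)"
    using DERIV_cong_ev[OF refl ev refl] by blast
  then have "2 * A 0 = 1" using \<phi>(3) DERIV_imp_deriv by metis
  then show ?thesis using that[OF A(1) _ _ E(3)] EA by simp
qed

text \<open>
  With the potential energy written as \<open>x\<^sup>2 A(x)\<close> and \<open>A(0) = 1 / 2\<close>, the root \<open>x \<surd>(2 A(x))\<close> of twice the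
  energy is analytic and has the sign of \<open>x\<close>.
\<close>

lemma energy_root_exists:
  assumes \<phi>: "analytic_germ \<phi>" "\<phi> 0 = 0" "deriv \<phi> 0 = 1"
  obtains Xi where "analytic_germ Xi" "Xi 0 = 0" "deriv Xi 0 = 1"
    "\<forall>\<^sub>F x in nhds 0. Xi x * deriv Xi x = \<phi> x"
proof -
  obtain E A where A: "analytic_germ A" "A 0 = 1 / 2" and EA: "\<forall>x. E x = x\<^sup>2 * A x"
    and dE: "\<forall>\<^sub>F x in nhds 0. (E has_real_derivative \<phi> x) (at x)"
    using primitive_square_factor[OF \<phi>] .
  define s where "s x = sqrt (2 * A x)" for x
  have s: "analytic_germ s"
    unfolding s_def by (rule analytic_germ_sqrt) (use A in auto)
  have s0: "s 0 = 1" using A(2) by (simp add: s_def)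
  define Xi where "Xi x = x * s x" for x
  have Xi: "analytic_germ Xi" unfolding Xi_def using s by (intro analytic_germ_mult analytic_germ_ident)
  have d0: "(Xi has_real_derivative s 0) (at 0)"
    unfolding Xi_def by (rule derivative_eq_intros analytic_germ_derivative_at_0[OF s] refl)+ simp
  have "\<forall>\<^sub>F x in nhds 0. A x > 0"
    using analytic_germ_eventually_pos[OF A(1)] A(2) by simp
  then have "\<forall>\<^sub>F x in nhds 0. (Xi x)\<^sup>2 = 2 * E x"
    by eventually_elim (simp add: Xi_def s_def EA power_mult_distrib)
  then have "\<forall>\<^sub>F x in nhds 0. \<forall>\<^sub>F t in nhds x. (Xi t)\<^sup>2 = 2 * E t"
    by (simp add: eventually_eventually)
  then have "\<forall>\<^sub>F x in nhds 0. Xi x * deriv Xi x = \<phi> x"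
    using dE analytic_germ_differentiable[OF Xi]
  proof eventually_elim
    case (elim x)
    have "((\<lambda>t. (Xi t)\<^sup>2) has_real_derivative 2 * (Xi x * deriv Xi x)) (at x)"
      by (rule derivative_eq_intros elim(3) refl)+ simp
    then have "((\<lambda>t. 2 * E t) has_real_derivative 2 * (Xi x * deriv Xi x)) (at x)"
      using DERIV_cong_ev[OF refl elim(1) refl] by blast
    moreover have "((\<lambda>t. 2 * E t) has_real_derivative 2 * \<phi> x) (at x)"
      by (rule DERIV_cmult[OF elim(2)])
    ultimately show ?case using DERIV_unique by fastforce
  qed
  then show ?thesis
    using that[OF Xi] d0 s0 by (simp add: Xi_def DERIV_imp_deriv)
qed

text \<open>
  Each requirement is an identity or a strict inequality between germs. Those that involve derivatives
  come from differentiating \<open>Xi (X \<xi>) = \<xi>\<close>; all of them hold on a common interval.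
\<close>

lemma energy_coordinates_exist:
  assumes f: "analytic_germ f" and g: "analytic_germ g" "g 0 = 0" "deriv g 0 = 1"
    and I: "open I" "0 \<in> I"
  obtains F X Xi w R where "energy_coordinates f g F X Xi w I R"
    "analytic_germ w" "w 0 = 1" "F 0 = 0"
proof -
  obtain F where F: "analytic_germ F" "F 0 = 0"
    "\<forall>\<^sub>F x in nhds 0. (F has_real_derivative f x) (at x)"
    using analytic_germ_primitive[OF f] .
  define \<phi> where "\<phi> x = g x * exp (2 * F x)" for x
  have \<phi>: "analytic_germ \<phi>"
    unfolding \<phi>_def using g(1) F(1) by (intro analytic_germ_mult analytic_germ_exp analytic_germ_const)
  have "(\<phi> has_real_derivative 1) (at 0)"
    unfolding \<phi>_def
    by (rule derivative_eq_intros analytic_germ_derivative_at_0[OF g(1)]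
        eventually_nhds_x_imp_x[OF F(3)] refl)+ (simp add: g F(2))
  then have \<phi>': "deriv \<phi> 0 = 1" by (rule DERIV_imp_deriv)
  have \<phi>0: "\<phi> 0 = 0" by (simp add: \<phi>_def g)
  obtain Xi where Xi: "analytic_germ Xi" "Xi 0 = 0" "deriv Xi 0 = 1"
    and Xi\<phi>: "\<forall>\<^sub>F x in nhds 0. Xi x * deriv Xi x = \<phi> x"
    using energy_root_exists[OF \<phi> \<phi>0 \<phi>'] .
  obtain X where X: "analytic_germ X" "X 0 = 0" and XiX: "\<forall>\<^sub>F \<xi> in nhds 0. Xi (X \<xi>) = \<xi>"
    using analytic_germ_right_inverse[OF Xi(1,2)] Xi(3) by auto
  note at_X = eventually_nhds_0_compose[OF analytic_germ_isCont[OF X(1)] X(2)]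
  have dX: "\<forall>\<^sub>F \<xi> in nhds 0. (X has_real_derivative deriv X \<xi>) (at \<xi>)"
    by (rule analytic_germ_differentiable[OF X(1)])
  have dXi: "\<forall>\<^sub>F \<xi> in nhds 0. (Xi has_real_derivative deriv Xi (X \<xi>)) (at (X \<xi>))"
    by (rule at_X[OF analytic_germ_differentiable[OF Xi(1)]])
  have "\<forall>\<^sub>F \<xi> in nhds 0. \<forall>\<^sub>F t in nhds \<xi>. Xi (X t) = t"
    using XiX by (simp add: eventually_eventually)
  then have one: "\<forall>\<^sub>F \<xi> in nhds 0. deriv Xi (X \<xi>) * deriv X \<xi> = 1"
    using dX dXi
  proof eventually_elim
    case (elim \<xi>)
    have "((\<lambda>t. Xi (X t)) has_real_derivative deriv Xi (X \<xi>) * deriv X \<xi>) (at \<xi>)"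
      by (rule DERIV_chain2[OF elim(3,2)])
    then have "((\<lambda>t. t) has_real_derivative deriv Xi (X \<xi>) * deriv X \<xi>) (at \<xi>)"
      using DERIV_cong_ev[OF refl elim(1) refl] by blast
    then show ?case using DERIV_unique DERIV_ident by blast
  qed
  have X'0: "deriv X 0 = 1" using eventually_nhds_x_imp_x[OF one] X(2) Xi(3) by simp
  define w where "w \<xi> = exp (F (X \<xi>)) * deriv X \<xi>" for \<xi>
  have w: "analytic_germ w"
    unfolding w_def
    by (rule analytic_germ_mult[OF analytic_germ_exp[OF analytic_germ_compose[OF F(1) X]]
          analytic_germ_deriv[OF X(1)]])
  have w0: "w 0 = 1" by (simp add: w_def X F(2) X'0)
  have "\<forall>\<^sub>F x in nhds 0. x \<in> I" using I by (rule eventually_nhds_in_open)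
  then have "\<forall>\<^sub>F \<xi> in nhds 0. X \<xi> \<in> I" by (rule at_X)
  moreover have "\<forall>\<^sub>F \<xi> in nhds 0. deriv X \<xi> > 0"
    using analytic_germ_eventually_pos[OF analytic_germ_deriv[OF X(1)]] X'0 by simp
  ultimately have "\<forall>\<^sub>F \<xi> in nhds 0. X \<xi> \<in> I \<and> (F has_real_derivative f (X \<xi>)) (at (X \<xi>)) \<and>
      (X has_real_derivative w \<xi> * exp (- F (X \<xi>))) (at \<xi>) \<and> Xi (X \<xi>) = \<xi> \<and>
      (Xi has_real_derivative exp (F (X \<xi>)) / w \<xi>) (at (X \<xi>)) \<and> w \<xi> > 0 \<and> isCont w \<xi> \<and>
      g (X \<xi>) * exp (F (X \<xi>)) * w \<xi> = \<xi>"
    using dX dXi one XiX at_X[OF F(3)] at_X[OF Xi\<phi>] analytic_germ_differentiable[OF w]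
  proof eventually_elim
    case (elim \<xi>)
    have "w \<xi> * exp (- F (X \<xi>)) = deriv X \<xi>" by (simp add: w_def exp_minus)
    moreover have "exp (F (X \<xi>)) / w \<xi> = deriv Xi (X \<xi>)"
      using elim(5) elim(2) by (simp add: w_def field_simps)
    moreover have "w \<xi> > 0" using elim(2) by (simp add: w_def)
    moreover have "isCont w \<xi>" using elim(9) by (rule DERIV_isCont)
    moreover have "g (X \<xi>) * exp (F (X \<xi>)) * w \<xi> = \<xi>"
    proof -
      have "g (X \<xi>) * exp (F (X \<xi>)) * w \<xi> = \<phi> (X \<xi>) * deriv X \<xi>"
        by (simp add: w_def \<phi>_def exp_double power2_eq_square)
      also have "\<dots> = \<xi> * (deriv Xi (X \<xi>) * deriv X \<xi>)"
        using elim(6,8) by simp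
      finally show ?thesis using elim(5) by simp
    qed
    ultimately show ?case
      using elim by simp
  qed
  then obtain R where "R > 0" and R: "\<forall>\<xi>. dist \<xi> 0 < R \<longrightarrow>
      X \<xi> \<in> I \<and> (F has_real_derivative f (X \<xi>)) (at (X \<xi>)) \<and>
      (X has_real_derivative w \<xi> * exp (- F (X \<xi>))) (at \<xi>) \<and> Xi (X \<xi>) = \<xi> \<and>
      (Xi has_real_derivative exp (F (X \<xi>)) / w \<xi>) (at (X \<xi>)) \<and> w \<xi> > 0 \<and> isCont w \<xi> \<and>
      g (X \<xi>) * exp (F (X \<xi>)) * w \<xi> = \<xi>"
    unfolding eventually_nhds_metric by blast
  then have "energy_coordinates f g F X Xi w I R"
    by unfold_locales (simp_all add: X(2))
  then show ?thesis using that w w0 F(2) by blast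
qed


section \<open>The two forms of the derivatives of the restoring force\<close>

text \<open>
  Put \<open>L\<^sub>k = Q\<^sub>k(X) exp ((1 - k) F(X))\<close> and \<open>R\<^sub>k = P\<^sub>k / w\<^bsup>2k+1\<^esup>\<close>. The recursion of \<open>Q\<close> says
  \<open>w L\<^bsub>k+1\<^esub> = L\<^sub>k'\<close>, that of \<open>P\<close> with \<open>h = w - 1\<close> says \<open>w R\<^bsub>k+1\<^esub> = R\<^sub>k'\<close>, and \<open>L\<^sub>0 = R\<^sub>0\<close> is the
  formula \<open>g(X) exp (F(X)) w = \<xi>\<close> for the restoring force.
\<close>

lemma P_hat_eq_Q_hat_in_energy_coordinates:
  assumes ec: "energy_coordinates f g F X Xi w I R"
    and f: "analytic_germ f" and g: "analytic_germ g" and w: "analytic_germ w"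
  shows "\<forall>\<^sub>F \<xi> in nhds 0. P_hat (\<lambda>\<xi>. w \<xi> - 1) k \<xi> =
    Q_hat f g k (X \<xi>) * exp ((1 - real k) * F (X \<xi>)) * w \<xi> ^ (2 * k + 1)"
proof -
  interpret energy_coordinates f g F X Xi w I R by (rule ec)
  have near: "\<forall>\<^sub>F \<xi> in nhds 0. \<xi> \<in> {-R<..<R}"
    using R_pos by (intro eventually_nhds_in_open) auto
  have contX: "isCont X 0" using X_deriv[of 0] R_pos DERIV_isCont by simp
  define h where "h \<xi> = w \<xi> - 1" for \<xi>
  have h: "analytic_germ h" unfolding h_def using w by (intro analytic_germ_diff analytic_germ_const)
  have "\<forall>\<^sub>F \<xi> in nhds 0. P_hat h k \<xi> =
    Q_hat f g k (X \<xi>) * exp ((1 - real k) * F (X \<xi>)) * w \<xi> ^ (2 * k + 1)"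
  proof (induction k)
    case 0
    show ?case using near
    proof eventually_elim
      case (elim \<xi>)
      then show ?case using restoring[of \<xi>] by (simp add: abs_less_iff)
    qed
  next
    case (Suc k)
    then have "\<forall>\<^sub>F \<xi> in nhds 0. \<forall>\<^sub>F t in nhds \<xi>. P_hat h k t =
        Q_hat f g k (X t) * exp ((1 - real k) * F (X t)) * w t ^ (2 * k + 1)"
      by (simp add: eventually_eventually)
    moreover have "\<forall>\<^sub>F \<xi> in nhds 0. (Q_hat f g k has_real_derivative deriv (Q_hat f g k) (X \<xi>)) (at (X \<xi>))"
      using eventually_nhds_0_compose[OF contX X_0 analytic_germ_differentiable[OF analytic_germ_Q_hat[OF f g, of k]]] .
    ultimately show ?case
      using near analytic_germ_differentiable[OF w] analytic_germ_differentiable[OF analytic_germ_P_hat[OF h, of k]]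
    proof eventually_elim
      case (elim \<xi>)
      then have a: "\<bar>\<xi>\<bar> < R" by (simp add: abs_less_iff)
      define e where "e = exp ((1 - real k) * F (X \<xi>))"
      define q where "q = Q_hat f g k (X \<xi>)"
      define x' where "x' = w \<xi> * exp (- F (X \<xi>))"
      have dX: "(X has_real_derivative x') (at \<xi>)" unfolding x'_def by (rule X_deriv[OF a])
      have dF: "((\<lambda>t. F (X t)) has_real_derivative f (X \<xi>) * x') (at \<xi>)"
        by (rule DERIV_chain2[OF F_deriv[OF a] dX])
      have dQ: "((\<lambda>t. Q_hat f g k (X t)) has_real_derivative deriv (Q_hat f g k) (X \<xi>) * x') (at \<xi>)"
        by (rule DERIV_chain2[OF elim(2) dX])
      have "((\<lambda>t. Q_hat f g k (X t) * exp ((1 - real k) * F (X t)) * w t ^ (2 * k + 1)) has_real_derivative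
          Q_hat f g (Suc k) (X \<xi>) * x' * e * w \<xi> ^ (2 * k + 1)
          + q * e * (real (2 * k + 1) * w \<xi> ^ (2 * k) * deriv w \<xi>)) (at \<xi>)"
        by (rule derivative_eq_intros dQ dF elim(4) refl)+
          (simp add: e_def q_def algebra_simps)
      then have "(P_hat h k has_real_derivative
          Q_hat f g (Suc k) (X \<xi>) * x' * e * w \<xi> ^ (2 * k + 1)
          + q * e * (real (2 * k + 1) * w \<xi> ^ (2 * k) * deriv w \<xi>)) (at \<xi>)"
        using DERIV_cong_ev[OF refl elim(1) refl] by blast
      then have P': "deriv (P_hat h k) \<xi> = Q_hat f g (Suc k) (X \<xi>) * x' * e * w \<xi> ^ (2 * k + 1)
          + q * e * (real (2 * k + 1) * w \<xi> ^ (2 * k) * deriv w \<xi>)"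
        by (rule DERIV_imp_deriv)
      have P: "P_hat h k \<xi> = q * e * w \<xi> ^ (2 * k + 1)"
        using eventually_nhds_x_imp_x[OF elim(1)] by (simp add: q_def e_def)
      have "(h has_real_derivative deriv w \<xi>) (at \<xi>)"
        unfolding h_def by (rule derivative_eq_intros elim(4) refl)+ simp
      then have h': "deriv h \<xi> = deriv w \<xi>" by (rule DERIV_imp_deriv)
      have e: "x' * e = w \<xi> * exp ((1 - real (Suc k)) * F (X \<xi>))"
        by (simp add: x'_def e_def algebra_simps flip: exp_add)
      have "P_hat h (Suc k) \<xi> = deriv (P_hat h k) \<xi> * w \<xi> - real (2 * k + 1) * P_hat h k \<xi> * deriv w \<xi>"
        by (simp add: h' h_def)
      also have "\<dots> = Q_hat f g (Suc k) (X \<xi>) * (x' * e) * w \<xi> ^ (2 * k + 2)"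
        unfolding P' P by (simp add: algebra_simps del: Q_hat.simps)
      also have "\<dots> = Q_hat f g (Suc k) (X \<xi>) * exp ((1 - real (Suc k)) * F (X \<xi>)) * w \<xi> ^ (2 * Suc k + 1)"
        unfolding e by (simp add: algebra_simps del: Q_hat.simps)
      finally show ?case .
    qed
  qed
  then show ?thesis by (simp add: h_def[abs_def])
qed


section \<open>The isochronicity criterion\<close>

lemma isochronous_iff_odd_solution:
  assumes f: "analytic_germ f" and g: "analytic_germ g" "g 0 = 0" "deriv g 0 = 1"
    and I: "open I" "0 \<in> I"
  shows "isochronous_center (lienard_field f g) (I \<times> UNIV) (0, 0) \<longleftrightarrow>
    (\<exists>h. odd_analytic_near_0 h \<and> (\<forall>k. P_hat h k 0 = Q_hat f g k 0))"
proof -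
  obtain F X Xi w R where ec: "energy_coordinates f g F X Xi w I R"
    and w: "analytic_germ w" "w 0 = 1" and F0: "F 0 = 0"
    using energy_coordinates_exist[OF f g I] .
  interpret energy_coordinates f g F X Xi w I R by (rule ec)
  define h0 where "h0 \<xi> = w \<xi> - 1" for \<xi>
  have h0: "analytic_germ h0" "h0 0 = 0"
    unfolding h0_def using w by (auto intro!: analytic_germ_diff analytic_germ_const)
  have PQ: "P_hat h0 k 0 = Q_hat f g k 0" for k
    using eventually_nhds_x_imp_x[OF P_hat_eq_Q_hat_in_energy_coordinates[OF ec f g(1) w(1)]]
    by (simp add: h0_def[abs_def] X_0 F0 w(2))
  have wminus: "analytic_germ (\<lambda>\<xi>. w (- \<xi>))"
    by (rule analytic_germ_compose[OF w(1) analytic_germ_minus[OF analytic_germ_ident]]) simp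
  show ?thesis
  proof
    assume iso: "isochronous_center (lienard_field f g) (I \<times> UNIV) (0, 0)"
    have "analytic_germ (\<lambda>\<xi>. w \<xi> + w (- \<xi>) - 2)" 
      using w(1) wminus by (intro analytic_germ_diff analytic_germ_add analytic_germ_const)
    then have "\<forall>\<^sub>F \<xi> in nhds 0. w \<xi> + w (- \<xi>) - 2 = 0"
      using even_part_constant_if_isochronous[OF iso w(2)] analytic_germ_zero_isolated by blast
    then have "\<forall>\<^sub>F \<xi> in nhds 0. h0 (- \<xi>) = - h0 \<xi>"
      by eventually_elim (simp add: h0_def)
    then show "\<exists>h. odd_analytic_near_0 h \<and> (\<forall>k. P_hat h k 0 = Q_hat f g k 0)"
      using h0 PQ odd_analytic_near_0_iff by blast
  next
    assume "\<exists>h. odd_analytic_near_0 h \<and> (\<forall>k. P_hat h k 0 = Q_hat f g k 0)"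
    then obtain h where h: "analytic_germ h" "\<forall>\<^sub>F x in nhds 0. h (- x) = - h x"
      "\<And>k. P_hat h k 0 = Q_hat f g k 0"
      unfolding odd_analytic_near_0_iff by blast
    have "h 0 = 0" using eventually_nhds_x_imp_x[OF h(2)] by simp
    then have ev: "\<forall>\<^sub>F x in nhds 0. h x = h0 x"
      using h h0 PQ by (intro P_hat_at_0_determines_germ) auto
    have "\<forall>\<^sub>F x in nhds 0. h (- x) = h0 (- x)"
      by (rule eventually_nhds_0_compose[OF _ _ ev]) auto
    then have "\<forall>\<^sub>F \<xi> in nhds 0. w \<xi> + w (- \<xi>) = 2"
      using ev h(2) by eventually_elim (simp add: h0_def)
    then obtain d where d: "d > 0" "\<And>\<xi>. \<bar>\<xi>\<bar> < d \<Longrightarrow> w \<xi> + w (- \<xi>) = 2"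
      unfolding eventually_nhds_metric by (auto simp: dist_real_def)
    have "energy_coordinates f g F X Xi w I (min d R)"
      using d(1) R_pos by (intro energy_coordinates_shrink[OF ec]) auto
    then show "isochronous_center (lienard_field f g) (I \<times> UNIV) (0, 0)"
      using energy_coordinates.isochronous_if_even_part_constant d(2) by fastforce
  qed
qed

theorem theorem2:
  fixes f g :: "real \<Rightarrow> real" and I :: "real set"
  assumes "open I" and "0 \<in> I"
    and "real_analytic_on f I" and "real_analytic_on g I"
    and "g 0 = 0" and "deriv g 0 = 1"
    and "\<And>x. x \<in> I \<Longrightarrow> x \<noteq> 0 \<Longrightarrow> x * g x > 0"
  shows "(isochronous_center (lienard_field f g) (I \<times> UNIV) (0, 0) \<longleftrightarrow>
            (\<exists>h. odd_analytic_near_0 h \<and> (\<forall>k. P_hat h k 0 = Q_hat f g k 0)))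
       \<and> (\<forall>h M k. odd_analytic_near_0 h \<and> M > 0 \<and> 1 \<le> k \<and> k \<le> M \<longrightarrow>
            P_hat h k has_fps_expansion taylor_fps (P_hat h k) \<and>
            Q_hat f g k has_fps_expansion taylor_fps (Q_hat f g k) \<and>
            P_trunc M h k = truncated_expansion (M - k) (P_hat h k) \<and>
            Q_trunc M f g k = truncated_expansion (M - k) (Q_hat f g k) \<and>
            (P_hat h k 0 = Q_hat f g k 0 \<longleftrightarrow>
               poly (P_trunc M h k) 0 = poly (Q_trunc M f g k) 0))"
proof (intro conjI allI impI)
  obtain F where F: "f has_fps_expansion F"
    using assms(2,3) by (force simp: real_analytic_on_def)
  obtain G where G: "g has_fps_expansion G"
    using assms(2,4) by (force simp: real_analytic_on_def)
  show "isochronous_center (lienard_field f g) (I \<times> UNIV) (0, 0) \<longleftrightarrow>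
      (\<exists>h. odd_analytic_near_0 h \<and> (\<forall>k. P_hat h k 0 = Q_hat f g k 0))"
    using F G assms(1,2,5,6) by (intro isochronous_iff_odd_solution) (auto simp: analytic_germ_def)
  fix h :: "real \<Rightarrow> real" and M k :: nat
  assume hyp: "odd_analytic_near_0 h \<and> M > 0 \<and> 1 \<le> k \<and> k \<le> M"
  then obtain H where H: "h has_fps_expansion H"
    by (auto simp: odd_analytic_near_0_iff analytic_germ_def)
  note P = P_hat_has_fps_expansion[OF H, of k] and Q = Q_hat_has_fps_expansion[OF F G, of k]
  show "P_hat h k has_fps_expansion taylor_fps (P_hat h k)"
    using P taylor_fps_eqI[OF P] by simp
  show "Q_hat f g k has_fps_expansion taylor_fps (Q_hat f g k)"
    using Q taylor_fps_eqI[OF Q] by simp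
  show PT: "P_trunc M h k = truncated_expansion (M - k) (P_hat h k)"
    using hyp by (intro poly_eqI) (simp add: coeff_P_trunc[OF H] coeff_truncated_expansion[OF P])
  show QT: "Q_trunc M f g k = truncated_expansion (M - k) (Q_hat f g k)"
    using hyp by (intro poly_eqI) (simp add: coeff_Q_trunc[OF F G] coeff_truncated_expansion[OF Q])
  show "P_hat h k 0 = Q_hat f g k 0 \<longleftrightarrow> poly (P_trunc M h k) 0 = poly (Q_trunc M f g k) 0"
    unfolding PT QT poly_0_coeff_0 coeff_truncated_expansion[OF P] coeff_truncated_expansion[OF Q]
    using has_fps_expansion_at_0[OF P] has_fps_expansion_at_0[OF Q] by simp
qed

end
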